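(* Consider the linear model $y_i=\mathbf{x}_i^{\mathsf T}\boldsymbol\beta_0+\epsilon_i$, $i=1,\dots,n$, where $\epsilon_1,\dots,\epsilon_n$ are independent and identically distributed random variables with mean $0$ and variance $\sigma^2$, and suppose $\frac1n\mathbf{X}^{\mathsf T}\mathbf{X}\to\mathbf{C}$, where $\mathbf{C}$ is a positive definite matrix. Write $\boldsymbol\beta_0=(\beta_{01},\dots,\beta_{0p})^{\mathsf T}=(\boldsymbol\beta_{10}^{\mathsf T},\boldsymbol\beta_{20}^{\mathsf T})^{\mathsf T}$ with $\boldsymbol\beta_{20}=0$, where $\boldsymbol\beta_{10}$ collects the nonzero components, and let $\mathbf{C}_{11}$ be the corresponding upper-left block of $\mathbf{C}$. Let $\widehat{\boldsymbol\beta}(\mathrm{ose})=(\widehat{\boldsymbol\beta}(\mathrm{ose})_1^{\mathsf T},\widehat{\boldsymbol\beta}(\mathrm{ose})_2^{\mathsf T})^{\mathsf T}$ be the one-step estimator $$\widehat{\boldsymbol\beta}(\mathrm{ose})=\arg\min_{\boldsymbol\beta}\ \tfrac12\|\mathbf{y}-\mathbf{X}\boldsymbol\beta\|^2+n\sum_{j=1}^p p_{\lambda_n}'(|\beta_j^{(0)}|)\,|\beta_j|,$$ where $\boldsymbol\beta^{(0)}$ is the ordinary least squares estimator. Let $p_{\lambda_n}(\cdot)$ be the SCAD penalty. If $\sqrt n\lambda_n\to\infty$ and $\lambda_n\to0$, then the one-step SCAD estimates $\widehat{\boldsymbol\beta}(\mathrm{ose})$ must satisfy: (a) Sparsity: with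 probability tending to one, $\widehat{\boldsymbol\beta}(\mathrm{ose})_2=0$. (b) Asymptotic normality: $\sqrt n(\widehat{\boldsymbol\beta}(\mathrm{ose})_1-\boldsymbol\beta_{10})\to N(0,\sigma^2\mathbf{C}_{11}^{-1})$ in distribution. In addition, consider $p_{\lambda_n}(\cdot)=\lambda_n p(\cdot)$. Suppose $p'(\cdot)$ is continuous on $(0,\infty)$ and there is some $s>0$ such that $p'(\theta)=O(\theta^{-s})$ as $\theta\to0+$. Then (a) and (b) hold, if $n^{(1+s)/2}\lambda_n\to\infty$ and $\sqrt n\lambda_n\to0$.
   Context: The data $(\mathbf{x}_i,y_i)$, $i=1,\dots,n$, are independent and identically distributed samples, where $\mathbf{x}_i\in\mathbb{R}^p$ is the predictor and $y_i$ the response; $\mathbf{X}$ is the $n\times p$ matrix with rows $\mathbf{x}_1^{\mathsf T},\dots,\mathbf{x}_n^{\mathsf T}$, and $\mathbf{y}=(y_1,\dots,y_n)^{\mathsf T}$. The dimension $p$ does not change with $n$. $\lambda_n>0$ is the regularization parameter. The subvectors with subscripts $1$ and $2$ of $\widehat{\boldsymbol\beta}(\mathrm{ose})$ correspond to the partition of $\boldsymbol\beta_0$. In $p_{\lambda_n}(\cdot)=\lambda_n p(\cdot)$, the symbol $p(\cdot)$ denotes a penalty function on $[0,\infty)$ (not the dimension). The SCAD penalty with parameter $\lambda$ is defined by $p_\lambda(0)=0$ and, for $\theta>0$, $p_\lambda'(\theta)=\lambda I(\theta\le\lambda)+\frac{(a\lambda-\theta)_+}{a-1}I(\theta>\lambda)$,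 for some $a>2$, where $I(\cdot)$ is the indicator function and $z_+=\max(z,0)$; at $0$ the right derivative is used.
   Formalization: p'(θ)=O(θ^{-s}) is taken as exact (two-sided) order, since with the upper bound alone p(θ)=θ, s=1, λ_n=n^{-3/4} is a counterexample; the penalty p is assumed nondecreasing; the errors are assumed independent of the predictors (fixed design included). *)

theory Defs
  imports "HOL-Probability.Probability"
begin

subsection \<open>Penalties\<close>

text \<open>
  Derivative of a penalty on \<open>[0,\<infinity>)\<close>. At \<open>0\<close> it is the right-hand limit of the derivative,
  which equals the right derivative when the penalty is continuous at \<open>0\<close> and is \<open>\<infinity>\<close> for
  penalties whose derivative blows up there (bridge, logarithm). The limit of the derivative is
  used instead of a difference quotient at \<open>0\<close> so that no meaningful value of the penalty at \<open>0\<close>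
  is needed: the logarithm penalty is \<open>-\<infinity>\<close> there.
\<close>
definition pen_deriv :: "(real \<Rightarrow> real) \<Rightarrow> real \<Rightarrow> ereal" where
  "pen_deriv p \<theta> =
     (if \<theta> = 0 then Lim (at_right 0) (\<lambda>t. ereal (deriv p t)) else ereal (deriv p \<theta>))"

definition scad_deriv :: "real \<Rightarrow> real \<Rightarrow> real \<Rightarrow> real" where
  "scad_deriv a lam \<theta> =
     lam * of_bool (\<theta> \<le> lam) + max (a * lam - \<theta>) 0 / (a - 1) * of_bool (\<theta> > lam)"

definition scad :: "real \<Rightarrow> real \<Rightarrow> real \<Rightarrow> real" where
  "scad a lam \<theta> = integral {0..\<theta>} (scad_deriv a lam)"

lemma scad_0: "scad a lam 0 = 0"
  by (simp add: scad_def)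

lemma scad_deriv_alt:
  assumes "a > 2" "lam > 0"
  shows "scad_deriv a lam \<theta> = min lam (max (a * lam - \<theta>) 0 / (a - 1))"
proof (cases "\<theta> \<le> lam")
  case True
  have "lam * (a - 1) \<le> a * lam - \<theta>" using True by (simp add: algebra_simps)
  then have "lam * (a - 1) \<le> max (a * lam - \<theta>) 0" by linarith
  then have "lam \<le> max (a * lam - \<theta>) 0 / (a - 1)"
    using assms by (simp add: pos_le_divide_eq)
  then show ?thesis using True by (simp add: scad_deriv_def)
next
  case False
  have "a * lam - \<theta> \<le> lam * (a - 1)" using False by (simp add: algebra_simps)
  moreover have "0 \<le> lam * (a - 1)" using assms by simp
  ultimately have "max (a * lam - \<theta>) 0 \<le> lam * (a - 1)" by simp
  then have "max (a * lam - \<theta>) 0 / (a - 1) \<le> lam"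
    using assms by (simp add: pos_divide_le_eq)
  then show ?thesis using False by (simp add: scad_deriv_def)
qed

lemma continuous_on_scad_deriv:
  assumes "a > 2" "lam > 0"
  shows "continuous_on A (scad_deriv a lam)"
proof -
  have "scad_deriv a lam = (\<lambda>\<theta>. min lam (max (a * lam - \<theta>) 0 / (a - 1)))"
    using scad_deriv_alt[OF assms] by auto
  then show ?thesis
    using assms by (auto intro!: continuous_intros)
qed

lemma has_real_derivative_scad:
  assumes "a > 2" "lam > 0" "\<theta> > 0"
  shows "(scad a lam has_real_derivative scad_deriv a lam \<theta>) (at \<theta>)"
proof -
  have "((\<lambda>u. integral {0..u} (scad_deriv a lam)) has_real_derivative scad_deriv a lam \<theta>)
          (at \<theta> within {0..\<theta> + 1})"
    by (rule integral_has_real_derivative) (use assms continuous_on_scad_deriv in auto)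
  moreover have "at \<theta> within {0..\<theta> + 1} = at \<theta>"
    using assms by (intro at_within_Icc_at) auto
  ultimately show ?thesis by (simp add: scad_def[abs_def])
qed

lemma has_real_derivative_scad_at_right_0:
  assumes "a > 2" "lam > 0"
  shows "(scad a lam has_real_derivative scad_deriv a lam 0) (at_right 0)"
proof -
  have "((\<lambda>u. integral {0..u} (scad_deriv a lam)) has_real_derivative scad_deriv a lam 0)
          (at 0 within {0..1})"
    by (rule integral_has_real_derivative) (use assms continuous_on_scad_deriv in auto)
  then show ?thesis
    by (simp add: scad_def[abs_def] at_within_Icc_at_right)
qed

lemma pen_deriv_scad:
  assumes "a > 2" "lam > 0" "\<theta> \<ge> 0"
  shows "pen_deriv (scad a lam) \<theta> = ereal (scad_deriv a lam \<theta>)"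
proof (cases "\<theta> = 0")
  case False
  then show ?thesis
    using assms DERIV_imp_deriv[OF has_real_derivative_scad[of a lam \<theta>]]
    by (simp add: pen_deriv_def)
next
  case True
  have "(scad_deriv a lam \<longlongrightarrow> scad_deriv a lam 0) (at_right 0)"
    using continuous_on_scad_deriv[of a lam UNIV] assms
    by (auto simp: continuous_on_def intro: filterlim_mono[OF _ order_refl at_le])
  then have "((\<lambda>t. ereal (scad_deriv a lam t)) \<longlongrightarrow> ereal (scad_deriv a lam 0)) (at_right 0)"
    by (rule tendsto_ereal)
  moreover have "\<forall>\<^sub>F t in at_right 0. ereal (scad_deriv a lam t) = ereal (deriv (scad a lam) t)"
    using eventually_at_right_less[of "0::real"]
    by eventually_elim (use assms has_real_derivative_scad DERIV_imp_deriv in fastforce)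
  ultimately have "((\<lambda>t. ereal (deriv (scad a lam) t)) \<longlongrightarrow> ereal (scad_deriv a lam 0)) (at_right 0)"
    by (rule Lim_transform_eventually)
  then show ?thesis
    using True by (simp add: pen_deriv_def tendsto_Lim)
qed

subsection \<open>Least squares and the one-step estimator\<close>

text \<open>
  Observations are indexed from \<open>0\<close>: the sample of size \<open>n\<close> consists of the pairs
  \<open>(x i, y i)\<close> with \<open>i < n\<close>, and \<open>rss n x y \<beta>\<close> is the squared norm of \<open>y - X \<beta>\<close>.
\<close>
definition rss :: "nat \<Rightarrow> (nat \<Rightarrow> real^'p) \<Rightarrow> (nat \<Rightarrow> real) \<Rightarrow> real^'p \<Rightarrow> real" where
  "rss n x y \<beta> = (\<Sum>i<n. (y i - x i \<bullet> \<beta>)\<^sup>2)"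

text \<open>The matrix \<open>X\<^sup>T X\<close> of the first \<open>n\<close> predictors.\<close>
definition gram :: "nat \<Rightarrow> (nat \<Rightarrow> real^'p) \<Rightarrow> real^'p^'p" where
  "gram n x = (\<chi> j k. \<Sum>i<n. x i $ j * x i $ k)"

text \<open>
  In \<open>ereal\<close>, \<open>\<infinity> * 0 = 0\<close>, so an infinite weight forces the corresponding coefficient to vanish.
\<close>
definition one_step_objective ::
  "nat \<Rightarrow> (nat \<Rightarrow> real^'p) \<Rightarrow> (nat \<Rightarrow> real) \<Rightarrow> (real \<Rightarrow> real) \<Rightarrow> real^'p \<Rightarrow> real^'p \<Rightarrow> ereal" where
  "one_step_objective n x y p \<beta>0 \<beta> =
     ereal (1 / 2 * rss n x y \<beta>) +
     ereal (real n) * (\<Sum>j\<in>UNIV. pen_deriv p \<bar>\<beta>0 $ j\<bar> * ereal \<bar>\<beta> $ j\<bar>)"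

text \<open>
  Minimizers need not be unique when \<open>X\<^sup>T X\<close> is singular; an estimator is any random vector
  that is almost surely a minimizer.
\<close>
definition ols_estimator ::
  "'a measure \<Rightarrow> (nat \<Rightarrow> 'a \<Rightarrow> real^'p) \<Rightarrow> (nat \<Rightarrow> 'a \<Rightarrow> real) \<Rightarrow> (nat \<Rightarrow> 'a \<Rightarrow> real^'p) \<Rightarrow> bool" where
  "ols_estimator M x y b \<longleftrightarrow>
     (\<forall>n. b n \<in> borel_measurable M \<and>
          (AE \<omega> in M. is_arg_min (rss n (\<lambda>i. x i \<omega>) (\<lambda>i. y i \<omega>)) (\<lambda>_. True) (b n \<omega>)))"

definition one_step_estimator ::
  "'a measure \<Rightarrow> (nat \<Rightarrow> 'a \<Rightarrow> real^'p) \<Rightarrow> (nat \<Rightarrow> 'a \<Rightarrow> real) \<Rightarrow> (nat \<Rightarrow> real \<Rightarrow> real) \<Rightarrow>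
   (nat \<Rightarrow> 'a \<Rightarrow> real^'p) \<Rightarrow> (nat \<Rightarrow> 'a \<Rightarrow> real^'p) \<Rightarrow> bool" where
  "one_step_estimator M x y p b0 b \<longleftrightarrow>
     (\<forall>n. b n \<in> borel_measurable M \<and>
          (AE \<omega> in M. is_arg_min
             (one_step_objective n (\<lambda>i. x i \<omega>) (\<lambda>i. y i \<omega>) (p n) (b0 n \<omega>)) (\<lambda>_. True) (b n \<omega>)))"

subsection \<open>The linear model\<close>

definition pos_definite :: "real^'n^'n \<Rightarrow> bool" where
  "pos_definite A \<longleftrightarrow> transpose A = A \<and> (\<forall>v. v \<noteq> 0 \<longrightarrow> v \<bullet> (A *v v) > 0)"

text \<open>
  The predictors are random and independent of the errors. They need not be identically
  distributed, so a fixed (deterministic) design is included as well as i.i.d. data.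
\<close>
definition linear_model ::
  "'a measure \<Rightarrow> (nat \<Rightarrow> 'a \<Rightarrow> real^'p) \<Rightarrow> (nat \<Rightarrow> 'a \<Rightarrow> real) \<Rightarrow> (nat \<Rightarrow> 'a \<Rightarrow> real) \<Rightarrow>
   real^'p \<Rightarrow> real \<Rightarrow> bool" where
  "linear_model M x \<epsilon> y \<beta>\<^sub>0 \<sigma> \<longleftrightarrow>
     prob_space M \<and>
     (\<forall>i. \<forall>\<omega>\<in>space M. y i \<omega> = x i \<omega> \<bullet> \<beta>\<^sub>0 + \<epsilon> i \<omega>) \<and>
     prob_space.indep_vars M (\<lambda>_. borel) \<epsilon> UNIV \<and>
     (\<forall>i. distr M borel (\<epsilon> i) = distr M borel (\<epsilon> 0)) \<and>
     (\<forall>i. integrable M (\<epsilon> i) \<and> prob_space.expectation M (\<epsilon> i) = 0) \<and>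
     (\<forall>i. integrable M (\<lambda>\<omega>. (\<epsilon> i \<omega>)\<^sup>2) \<and> prob_space.variance M (\<epsilon> i) = \<sigma>\<^sup>2) \<and>
     (\<forall>i. x i \<in> borel_measurable M) \<and>
     prob_space.indep_set M
       (sets (vimage_algebra (space M) (\<lambda>\<omega> i. x i \<omega>) (Pi\<^sub>M UNIV (\<lambda>_. borel))))
       (sets (vimage_algebra (space M) (\<lambda>\<omega> i. \<epsilon> i \<omega>) (Pi\<^sub>M UNIV (\<lambda>_. borel))))"

subsection \<open>Convergence in distribution and the multivariate normal law\<close>

definition conv_in_distribution ::
  "'a measure \<Rightarrow> (nat \<Rightarrow> 'a \<Rightarrow> 'b::topological_space) \<Rightarrow> 'b measure \<Rightarrow> bool" where
  "conv_in_distribution M Z N \<longleftrightarrow>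
     (\<forall>f :: 'b \<Rightarrow> real. continuous_on UNIV f \<and> bounded (range f) \<longrightarrow>
        (\<lambda>n. \<integral>\<omega>. f (Z n \<omega>) \<partial>M) \<longlonglongrightarrow> (\<integral>z. f z \<partial>N))"

text \<open>
  \<open>N(\<mu>, S)\<close> is the law of \<open>\<mu> + A z\<close>, where \<open>z\<close> has independent standard normal coordinates
  and \<open>A A\<^sup>T = S\<close>; it does not depend on the choice of \<open>A\<close>. Unlike the density, this makes sense
  for singular \<open>S\<close>, in particular for variance \<open>0\<close>.
\<close>
definition multi_normal :: "real^'n \<Rightarrow> real^'n^'n \<Rightarrow> (real^'n) measure" where
  "multi_normal \<mu> S =
     distr (Pi\<^sub>M UNIV (\<lambda>_::'n. density lborel std_normal_density)) borel
       (\<lambda>z. \<mu> + (SOME A :: real^'n^'n. A ** transpose A = S) *v (\<chi> j. z j))"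

subsection \<open>The partition into nonzero and zero coefficients\<close>

text \<open>
  The nonzero coefficients are selected by an injection \<open>e\<close> from an index type \<open>'q\<close> whose range
  is the set of their positions.
\<close>
definition subvec :: "('q \<Rightarrow> 'p) \<Rightarrow> real^'p \<Rightarrow> real^'q" where
  "subvec e v = (\<chi> i. v $ e i)"

definition submat :: "('q \<Rightarrow> 'p) \<Rightarrow> real^'p^'p \<Rightarrow> real^'q^'q" where
  "submat e A = (\<chi> i k. A $ e i $ e k)"

definition sparsity :: "'a measure \<Rightarrow> real^'p \<Rightarrow> (nat \<Rightarrow> 'a \<Rightarrow> real^'p) \<Rightarrow> bool" where
  "sparsity M \<beta>\<^sub>0 b \<longleftrightarrow>
     (\<lambda>n. measure M {\<omega> \<in> space M. \<forall>j. \<beta>\<^sub>0 $ j = 0 \<longrightarrow> b n \<omega> $ j = 0}) \<longlonglongrightarrow> 1"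

text \<open>
  If no coefficient is nonzero there is no such \<open>e\<close>, since types are nonempty, and the
  statement about the (empty) first block is vacuous, as it should be.
\<close>
definition asymptotic_normality ::
  "('q::finite \<Rightarrow> 'p::finite) \<Rightarrow> 'a measure \<Rightarrow> real^'p \<Rightarrow> real \<Rightarrow> real^'p^'p \<Rightarrow> (nat \<Rightarrow> 'a \<Rightarrow> real^'p) \<Rightarrow> bool" where
  "asymptotic_normality e M \<beta>\<^sub>0 \<sigma> C b \<longleftrightarrow>
     (bij_betw e UNIV {j. \<beta>\<^sub>0 $ j \<noteq> 0} \<longrightarrow>
      conv_in_distribution M
        (\<lambda>n \<omega>. sqrt (real n) *\<^sub>R (subvec e (b n \<omega>) - subvec e \<beta>\<^sub>0))
        (multi_normal 0 (\<sigma>\<^sup>2 *\<^sub>R matrix_inv (submat e C))))"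

end

theory Submission
  imports Defs "HOL-Real_Asymp.Real_Asymp"
begin

text \<open>
  Write \<open>u = sqrt n (b - \<beta>\<^sub>0)\<close> for the local parameter, \<open>W\<close> for the score \<open>X\<^sup>T \<epsilon> / sqrt n\<close> and \<open>G\<close> for
  \<open>X\<^sup>T X / n\<close>. Up to a constant, the one-step criterion is
  \<open>u \<bullet> G u / 2 - W \<bullet> u + \<Sum>j. \<kappa> j * \<bar>sqrt n \<beta>\<^sub>0 $ j + u $ j\<bar>\<close>, where \<open>\<kappa> j\<close> is \<open>sqrt n\<close> times the derivative of
  the penalty at the absolute value of the \<open>j\<close>-th least squares coefficient.

  The proof has a probabilistic and a deterministic half. The probabilistic half is a central limit
  theorem for the score under a random design (\<open>char_score_tendsto\<close>): given the design, the score
  is a weighted sum of independent errors, the convergence of \<open>G\<close> makes the weights negligible, and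
  dominated convergence removes the conditioning. It yields the normal limit and, through tightness
  (\<open>tight_if_char_tendsto\<close>), that \<open>W\<close> is bounded in probability. Convergence in distribution in several
  dimensions is obtained from characteristic functions by \<open>conv_in_distribution_if_char_tendsto\<close>, where
  continuous functions are approximated by trigonometric polynomials.

  The deterministic half (\<open>one_step_minimizer_selection\<close>) concerns one sample with \<open>G\<close> close to \<open>C\<close> and
  \<open>W\<close> bounded. Least squares is then within \<open>O(1 / sqrt n)\<close> of \<open>\<beta>\<^sub>0\<close>. Under both sets of assumptions on the
  penalty this makes \<open>\<kappa> j\<close> large when \<open>\<beta>\<^sub>0 $ j = 0\<close> and small otherwise, a dichotomy isolated in
  \<open>separating_penalties\<close>. Small weights at the nonzero coefficients keep \<open>u\<close> bounded. Large weights at the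
  others make it profitable to set these coordinates of \<open>u\<close> to \<open>0\<close>, which is sparsity. The remaining
  coordinates satisfy the normal equations up to the size of their weights: the block of \<open>C\<close> that belongs
  to them maps them to the corresponding block of \<open>W\<close>, up to a small error, and the limit law of \<open>W\<close> gives
  asymptotic normality.
\<close>

section \<open>Levy's continuity theorem in several dimensions\<close>

text \<open>
  Trigonometric polynomials with arbitrary real frequencies. Phase-shifted cosines as generators
  make the class closed under products, by the product-to-sum formula, and an expectation of a
  generator is the real part of a multiple of the characteristic function at its frequency.
\<close>
inductive trig_sum :: "(real^'q \<Rightarrow> real) \<Rightarrow> bool" where
  wave: "trig_sum (\<lambda>x. c * cos (t \<bullet> x + a))"
| add: "trig_sum g \<Longrightarrow> trig_sum h \<Longrightarrow> trig_sum (\<lambda>x. g x + h x)"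

lemma trig_sum_mult_wave:
  assumes "trig_sum g"
  shows "trig_sum (\<lambda>x. (c * cos (t \<bullet> x + a)) * g x)"
  using assms
proof induction
  case (wave c' t' a')
  have "(\<lambda>x. c * cos (t \<bullet> x + a) * (c' * cos (t' \<bullet> x + a'))) =
        (\<lambda>x. (c * c' / 2) * cos ((t - t') \<bullet> x + (a - a')) + (c * c' / 2) * cos ((t + t') \<bullet> x + (a + a')))"
  proof
    fix x
    have "c * cos (t \<bullet> x + a) * (c' * cos (t' \<bullet> x + a')) = c * c' * (cos (t \<bullet> x + a) * cos (t' \<bullet> x + a'))"
      by simp
    also have "\<dots> = c * c' * ((cos ((t - t') \<bullet> x + (a - a')) + cos ((t + t') \<bullet> x + (a + a'))) / 2)"
      by (subst cos_times_cos) (simp add: inner_diff_left inner_add_left algebra_simps)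
    finally show "c * cos (t \<bullet> x + a) * (c' * cos (t' \<bullet> x + a')) =
        (c * c' / 2) * cos ((t - t') \<bullet> x + (a - a')) + (c * c' / 2) * cos ((t + t') \<bullet> x + (a + a'))"
      by (simp add: algebra_simps)
  qed
  then show ?case by (simp only:) (intro trig_sum.intros)
next
  case (add g h)
  then show ?case using trig_sum.add[OF add.IH] by (simp add: distrib_left)
qed

lemma trig_sum_mult:
  assumes "trig_sum g" "trig_sum h"
  shows "trig_sum (\<lambda>x. g x * h x)"
  using assms(1)
proof induction
  case (wave c t a)
  then show ?case using trig_sum_mult_wave[OF assms(2)] by simp
next
  case (add g1 g2)
  then show ?case using trig_sum.add[OF add.IH] by (simp add: distrib_right)
qed

lemma trig_sum_const: "trig_sum (\<lambda>x. c)"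
  using trig_sum.wave[of c 0 0] by simp

lemma trig_sum_sin: "trig_sum (\<lambda>x. c * sin (t \<bullet> x))"
proof -
  have "(\<lambda>x. c * sin (t \<bullet> x)) = (\<lambda>x. c * cos (t \<bullet> x + (- (pi / 2))))"
    by (simp add: cos_diff)
  then show ?thesis by (simp only: trig_sum.wave)
qed

lemma trig_sum_sum:
  assumes "finite A" "\<And>i. i \<in> A \<Longrightarrow> trig_sum (g i)"
  shows "trig_sum (\<lambda>x. \<Sum>i\<in>A. g i x)"
  using assms
proof (induction A)
  case empty
  show ?case by (simp add: trig_sum_const)
next
  case (insert i A)
  then show ?case by (simp add: trig_sum.add)
qed

lemma trig_sum_polynomial_of_sines:
  fixes P :: "real^'q \<Rightarrow> real"
  assumes "real_polynomial_function P"
  shows "trig_sum (\<lambda>x. P (\<chi> j. sin (r * x $ j)))"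
  using assms
proof induction
  case (linear P)
  interpret bounded_linear P by fact
  have P: "P v = (\<Sum>j\<in>UNIV. P (axis j 1) * v $ j)" for v
  proof -
    have "P v = P (\<Sum>j\<in>UNIV. (v $ j) *\<^sub>R axis j 1)"
      by (simp add: basis_expansion flip: scalar_mult_eq_scaleR)
    then show ?thesis by (simp add: sum scaleR mult.commute)
  qed
  have "(\<lambda>x::real^'q. P (\<chi> j. sin (r * x $ j))) = (\<lambda>x. \<Sum>j\<in>UNIV. P (axis j 1) * sin (axis j r \<bullet> x))"
    by (rule ext, subst P) (simp add: inner_axis')
  then show ?case by (simp only:) (intro trig_sum_sum trig_sum_sin; simp)
next
  case (const c)
  then show ?case by (rule trig_sum_const)
next
  case (add P Q)
  then show ?case by (intro trig_sum.add)
next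
  case (mult P Q)
  then show ?case by (intro trig_sum_mult)
qed

lemma trig_sum_bounded_continuous:
  assumes "trig_sum g"
  shows "continuous_on UNIV g \<and> (\<exists>B. \<forall>x. \<bar>g x\<bar> \<le> B)"
  using assms
proof induction
  case (wave c t a)
  have "\<bar>c * cos (t \<bullet> x + a)\<bar> \<le> \<bar>c\<bar>" for x
    using mult_left_mono[OF abs_cos_le_one[of "t \<bullet> x + a"], of "\<bar>c\<bar>"] by (simp add: abs_mult)
  then show ?case by (auto intro!: continuous_intros)
next
  case (add g h)
  then obtain B B' where "\<forall>x. \<bar>g x\<bar> \<le> B" "\<forall>x. \<bar>h x\<bar> \<le> B'" by blast
  then have "\<forall>x. \<bar>g x + h x\<bar> \<le> B + B'"
    by (meson abs_triangle_ineq add_mono order_trans)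
  with add show ?case by (auto intro!: continuous_intros)
qed

lemma (in prob_space) integrable_bounded_continuous:
  fixes f :: "'b::{second_countable_topology,metric_space} \<Rightarrow> real"
  assumes "Z \<in> borel_measurable M" "continuous_on UNIV f" "\<And>z. \<bar>f z\<bar> \<le> B"
  shows "integrable M (\<lambda>\<omega>. f (Z \<omega>))"
proof (rule integrable_const_bound)
  show "(\<lambda>\<omega>. f (Z \<omega>)) \<in> borel_measurable M"
    using borel_measurable_continuous_on[OF assms(2,1)] .
qed (use assms in auto)

lemma (in prob_space) integral_wave:
  fixes Z :: "'a \<Rightarrow> real^'q"
  assumes Z: "Z \<in> borel_measurable M"
  shows "(\<integral>\<omega>. c * cos (t \<bullet> Z \<omega> + a) \<partial>M) = Re (c * iexp a * (\<integral>\<omega>. iexp (t \<bullet> Z \<omega>) \<partial>M))"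
proof -
  have int: "integrable M (\<lambda>\<omega>. iexp (t \<bullet> Z \<omega>))"
    using Z by (intro integrable_iexp) auto
  have "(\<integral>\<omega>. c * cos (t \<bullet> Z \<omega> + a) \<partial>M) = (\<integral>\<omega>. Re (c * iexp a * iexp (t \<bullet> Z \<omega>)) \<partial>M)"
    by (intro Bochner_Integration.integral_cong)
       (auto simp: Re_exp Im_exp cos_add algebra_simps)
  also have "\<dots> = Re (\<integral>\<omega>. c * iexp a * iexp (t \<bullet> Z \<omega>) \<partial>M)"
    by (rule integral_Re) (intro integrable_mult_right int)
  finally show ?thesis by simp
qed

lemma integral_trig_sum_tendsto:
  fixes Z :: "nat \<Rightarrow> 'a \<Rightarrow> real^'q" and N :: "(real^'q) measure"
  assumes "prob_space M" "prob_space N" and sN: "sets N = sets borel"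
    and Z: "\<And>n. Z n \<in> borel_measurable M"
    and char: "\<And>t. (\<lambda>n. \<integral>\<omega>. iexp (t \<bullet> Z n \<omega>) \<partial>M) \<longlonglongrightarrow> (\<integral>z. iexp (t \<bullet> z) \<partial>N)"
    and "trig_sum g"
  shows "(\<lambda>n. \<integral>\<omega>. g (Z n \<omega>) \<partial>M) \<longlonglongrightarrow> (\<integral>z. g z \<partial>N)"
  using \<open>trig_sum g\<close>
proof induction
  interpret M: prob_space M by fact
  interpret N: prob_space N by fact
  have id: "(\<lambda>z. z) \<in> borel_measurable N" by (simp add: measurable_ident_sets sN)
  {
    case (wave c t a)
    show ?case
      unfolding M.integral_wave[OF Z] N.integral_wave[OF id]
      by (intro tendsto_intros char)
  next
    case (add g h)
    obtain B B' where *: "continuous_on UNIV g" "\<And>x. \<bar>g x\<bar> \<le> B" "continuous_on UNIV h" "\<And>x. \<bar>h x\<bar> \<le> B'"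
      using add.hyps[THEN trig_sum_bounded_continuous] by blast
    show ?case
      using M.integrable_bounded_continuous[OF Z *(1,2)] N.integrable_bounded_continuous[OF id *(1,2)]
        M.integrable_bounded_continuous[OF Z *(3,4)] N.integrable_bounded_continuous[OF id *(3,4)]
      by (simp add: tendsto_add add.IH)
  }
qed

text \<open>
  In one dimension Levy's theorem gives weak convergence. The bound on the tail
  comes from testing against a continuous function that vanishes on an interval and
  dominates the indicator of the complement of a slightly longer one.
\<close>
lemma tight_coordinate_if_char_tendsto:
  fixes Z :: "nat \<Rightarrow> 'a \<Rightarrow> real" and N :: "real measure"
  assumes "prob_space M" "real_distribution N"
    and Z: "\<And>n. Z n \<in> borel_measurable M"
    and char: "\<And>t. (\<lambda>n. \<integral>\<omega>. iexp (t * Z n \<omega>) \<partial>M) \<longlonglongrightarrow> char N t"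
    and "\<delta> > 0"
  shows "\<exists>K>0. \<forall>\<^sub>F n in sequentially. measure M {\<omega>\<in>space M. \<bar>Z n \<omega>\<bar> > K} < \<delta>"
proof -
  interpret M: prob_space M by fact
  interpret N: real_distribution N by fact
  \<comment> \<open>a ramp from \<open>0\<close> at \<open>\<bar>x\<bar> = K\<close> to \<open>1\<close> at \<open>\<bar>x\<bar> = K + 1\<close>\<close>
  define h where "h K x = min 1 (max 0 (\<bar>x\<bar> - K))" for K x :: real
  have h: "continuous_on UNIV (h K)" "\<bar>h K x\<bar> \<le> 1" "0 \<le> h K x" for K x
    by (auto simp: h_def[abs_def] intro!: continuous_intros)
  have "weak_conv_m (\<lambda>n. distr M borel (Z n)) N"
  proof (rule levy_continuity)
    show "(\<lambda>n. char (distr M borel (Z n)) t) \<longlonglongrightarrow> char N t" for t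
      using char[of t] Z by (simp add: char_def integral_distr)
  qed (use Z assms in auto)
  then have conv: "(\<lambda>n. \<integral>x. h K x \<partial>distr M borel (Z n)) \<longlonglongrightarrow> (\<integral>x. h K x \<partial>N)" for K
    using h Z assms
    by (intro weak_conv_imp_integral_bdd_continuous_conv[where B = 1])
       (auto simp: continuous_on_eq_continuous_at)
  have "(\<lambda>k. \<integral>x. h (real k) x \<partial>N) \<longlonglongrightarrow> (\<integral>x. 0 \<partial>N)"
  proof (rule integral_dominated_convergence[where w = "\<lambda>_. 1"])
    show "AE x in N. (\<lambda>k. h (real k) x) \<longlonglongrightarrow> 0"
    proof (rule AE_I2, rule tendsto_eventually)
      fix x
      show "\<forall>\<^sub>F k in sequentially. h (real k) x = 0"
        using eventually_ge_at_top[of "nat \<lceil>\<bar>x\<bar>\<rceil>"]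
        by eventually_elim (auto simp: h_def nat_ceiling_le_eq)
    qed
  qed (use h borel_measurable_continuous_onI[OF h(1)] in \<open>auto simp: measurable_cong_sets[OF N.events_eq_borel refl]\<close>)
  then have "\<forall>\<^sub>F k in sequentially. (\<integral>x. h (real k) x \<partial>N) < \<delta>"
    using \<open>\<delta> > 0\<close> by (auto dest: order_tendstoD)
  then obtain k where k: "(\<integral>x. h (real k) x \<partial>N) < \<delta>"
    by (auto simp: eventually_sequentially)
  have "\<forall>\<^sub>F n in sequentially. measure M {\<omega>\<in>space M. \<bar>Z n \<omega>\<bar> > real k + 1} < \<delta>"
    using order_tendstoD(2)[OF conv k]
  proof eventually_elim
    case (elim n)
    have [measurable]: "Z n \<in> borel_measurable M" "h (real k) \<in> borel_measurable borel"
      using Z h by (auto intro!: borel_measurable_continuous_onI)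
    have "measure M {\<omega>\<in>space M. \<bar>Z n \<omega>\<bar> > real k + 1} =
          (\<integral>\<omega>. indicator {\<omega>\<in>space M. \<bar>Z n \<omega>\<bar> > real k + 1} \<omega> \<partial>M)"
      by simp
    also have "\<dots> \<le> (\<integral>\<omega>. h (real k) (Z n \<omega>) \<partial>M)"
    proof (rule integral_mono)
      show "indicator {\<omega>\<in>space M. \<bar>Z n \<omega>\<bar> > real k + 1} \<omega> \<le> h (real k) (Z n \<omega>)" for \<omega>
        by (auto simp: h_def indicator_def)
    qed (use M.integrable_bounded_continuous[OF Z h(1,2)]
         in \<open>auto intro!: integrable_real_indicator simp: M.emeasure_eq_measure\<close>)
    also have "\<dots> < \<delta>"
      using elim by (simp add: integral_distr)
    finally show ?case .
  qed
  then show ?thesis by (intro exI[of _ "real k + 1"]) auto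
qed

text \<open>
  A vector is large only if one of its coordinates is, and the characteristic function of a
  coordinate is the restriction of the characteristic function to a coordinate axis.
\<close>
lemma tight_if_char_tendsto:
  fixes Z :: "nat \<Rightarrow> 'a \<Rightarrow> real^'q" and N :: "(real^'q) measure"
  assumes "prob_space M" "prob_space N" and sN: "sets N = sets borel"
    and Z: "\<And>n. Z n \<in> borel_measurable M"
    and char: "\<And>t. (\<lambda>n. \<integral>\<omega>. iexp (t \<bullet> Z n \<omega>) \<partial>M) \<longlonglongrightarrow> (\<integral>z. iexp (t \<bullet> z) \<partial>N)"
    and "\<delta> > 0"
  shows "\<exists>K>0. \<forall>\<^sub>F n in sequentially. measure M {\<omega>\<in>space M. norm (Z n \<omega>) > K} < \<delta>"
proof -
  interpret M: prob_space M by fact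
  interpret N: prob_space N by fact
  note [measurable_cong] = sN
  let ?d = "real CARD('q)"
  have "\<exists>K>0. \<forall>\<^sub>F n in sequentially. measure M {\<omega>\<in>space M. \<bar>Z n \<omega> $ j\<bar> > K} < \<delta> / ?d" for j
  proof (rule tight_coordinate_if_char_tendsto)
    show "(\<lambda>\<omega>. Z n \<omega> $ j) \<in> borel_measurable M" for n
      by (rule borel_measurable_continuous_on[OF _ Z]) (intro continuous_intros)
    show "real_distribution (distr N borel (\<lambda>z. z $ j))"
      by (intro N.real_distribution_distr) simp
    show "(\<lambda>n. \<integral>\<omega>. iexp (t * Z n \<omega> $ j) \<partial>M) \<longlonglongrightarrow> char (distr N borel (\<lambda>z. z $ j)) t" for t
      using char[of "axis j t"] by (simp add: char_def integral_distr inner_axis')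
  qed (use assms in auto)
  then have "\<forall>j. \<exists>K>0. \<forall>\<^sub>F n in sequentially. measure M {\<omega>\<in>space M. \<bar>Z n \<omega> $ j\<bar> > K} < \<delta> / ?d"
    by (rule allI)
  from choice[OF this] obtain K where K: "\<And>j. K j > 0"
      "\<And>j. \<forall>\<^sub>F n in sequentially. measure M {\<omega>\<in>space M. \<bar>Z n \<omega> $ j\<bar> > K j} < \<delta> / ?d"
    by auto
  define B where "B = (\<Sum>j\<in>UNIV. K j)"
  have "\<forall>\<^sub>F n in sequentially. \<forall>j\<in>UNIV. measure M {\<omega>\<in>space M. \<bar>Z n \<omega> $ j\<bar> > K j} < \<delta> / ?d"
    using K(2) by (intro eventually_ball_finite) auto
  then have "\<forall>\<^sub>F n in sequentially. measure M {\<omega>\<in>space M. norm (Z n \<omega>) > B} < \<delta>"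
  proof eventually_elim
    case (elim n)
    have [measurable]: "Z n \<in> borel_measurable M" by fact
    have "{\<omega>\<in>space M. norm (Z n \<omega>) > B} \<subseteq> (\<Union>j. {\<omega>\<in>space M. \<bar>Z n \<omega> $ j\<bar> > K j})"
    proof (rule subsetI, rule ccontr)
      fix \<omega> assume *: "\<omega> \<in> {\<omega>\<in>space M. norm (Z n \<omega>) > B}" "\<omega> \<notin> (\<Union>j. {\<omega>\<in>space M. \<bar>Z n \<omega> $ j\<bar> > K j})"
      then have "(\<Sum>j\<in>UNIV. \<bar>Z n \<omega> $ j\<bar>) \<le> B"
        unfolding B_def by (intro sum_mono) (auto simp: not_less)
      with norm_le_l1_cart[of "Z n \<omega>"] * show False by auto
    qed
    then have "measure M {\<omega>\<in>space M. norm (Z n \<omega>) > B} \<le> measure M (\<Union>j. {\<omega>\<in>space M. \<bar>Z n \<omega> $ j\<bar> > K j})"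
      by (intro M.finite_measure_mono) auto
    also have "\<dots> \<le> (\<Sum>j\<in>UNIV. measure M {\<omega>\<in>space M. \<bar>Z n \<omega> $ j\<bar> > K j})"
      by (intro M.finite_measure_subadditive_finite) auto
    also have "\<dots> < (\<Sum>j\<in>(UNIV::'q set). \<delta> / ?d)"
      using elim by (intro sum_strict_mono) auto
    also have "\<dots> = \<delta>" by simp
    finally show ?case .
  qed
  moreover have "B > 0" unfolding B_def using K(1) by (intro sum_pos) auto
  ultimately show ?thesis by blast
qed

text \<open>
  The triangle wave
  \<open>K * arcsin (sin (z / K))\<close> is the identity for \<open>\<bar>z\<bar> \<le> K\<close>, so \<open>f\<close> agrees on the ball with a function of the
  bounded variables \<open>sin (x $ j / K)\<close>, and on the cube in which these variables lie the
  Stone-Weierstrass theorem supplies a polynomial. The approximation is uniform in the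
  variables \<open>sin (x $ j / K)\<close>, hence the bound also holds off the ball.
\<close>
lemma trig_sum_approx:
  fixes f :: "real^'q \<Rightarrow> real"
  assumes f: "continuous_on UNIV f" "\<And>x. \<bar>f x\<bar> \<le> B" and "K > 0" "\<eta> > 0"
  obtains g where "trig_sum g" "\<And>x. \<bar>g x\<bar> \<le> B + \<eta>" "\<And>x. norm x \<le> K \<Longrightarrow> \<bar>f x - g x\<bar> \<le> \<eta>"
proof -
  define F where "F s = f (\<chi> j. K * arcsin (s $ j))" for s :: "real^'q"
  define S :: "(real^'q) set" where "S = {s. \<forall>j. s $ j \<in> {-1..1}}"
  define \<Phi> :: "real^'q \<Rightarrow> real^'q" where "\<Phi> x = (\<chi> j. sin ((1 / K) * x $ j))" for x
  have S: "S = cbox (\<chi> j. -1) (\<chi> j. 1)" by (auto simp: S_def mem_box_cart)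
  have "continuous_on S F"
    unfolding F_def
    by (intro continuous_on_compose2[OF f(1)] continuous_on_vec_lambda continuous_intros)
       (auto simp: S_def)
  then obtain P where P: "real_polynomial_function P" "\<And>s. s \<in> S \<Longrightarrow> \<bar>F s - P s\<bar> < \<eta>"
    using Stone_Weierstrass_real_polynomial_function[of S F \<eta>] \<open>\<eta> > 0\<close> S by auto
  have \<Phi>: "\<Phi> x \<in> S" for x by (auto simp: \<Phi>_def S_def)
  show thesis
  proof
    show "trig_sum (\<lambda>x. P (\<Phi> x))"
      unfolding \<Phi>_def by (rule trig_sum_polynomial_of_sines[OF P(1)])
    show "\<bar>P (\<Phi> x)\<bar> \<le> B + \<eta>" for x
      using P(2)[OF \<Phi>[of x]] f(2)[of "\<chi> j. K * arcsin (\<Phi> x $ j)"] unfolding F_def by linarith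
    show "\<bar>f x - P (\<Phi> x)\<bar> \<le> \<eta>" if "norm x \<le> K" for x
    proof -
      have "K * arcsin (\<Phi> x $ j) = x $ j" for j
      proof -
        have "\<bar>x $ j\<bar> \<le> K" using component_le_norm_cart[of x j] that by simp
        then have "- 1 \<le> x $ j / K" "x $ j / K \<le> 1" using \<open>K > 0\<close> by (auto simp: field_simps)
        then have "arcsin (sin (x $ j / K)) = x $ j / K"
          using pi_gt3 by (intro arcsin_sin) linarith+
        then show ?thesis using \<open>K > 0\<close> by (simp add: \<Phi>_def)
      qed
      then have "F (\<Phi> x) = f x" by (simp add: F_def)
      then show ?thesis using P(2)[OF \<Phi>[of x]] by simp
    qed
  qed
qed

text \<open>
  Splitting an expectation along an event: the difference is small off the event and bounded on it.
  All comparisons of expectations below are of this form, with an event of small probability.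
\<close>
lemma (in prob_space) integral_diff_le_off_event:
  fixes f g :: "'a \<Rightarrow> 'b::{banach,second_countable_topology}"
  assumes "integrable M f" "integrable M g" "A \<in> sets M"
    and "AE \<omega> in M. \<omega> \<notin> A \<longrightarrow> norm (f \<omega> - g \<omega>) \<le> \<eta>"
    and "AE \<omega> in M. norm (f \<omega> - g \<omega>) \<le> B" and "\<eta> \<ge> 0"
  shows "norm ((\<integral>\<omega>. f \<omega> \<partial>M) - (\<integral>\<omega>. g \<omega> \<partial>M)) \<le> \<eta> + B * measure M A"
proof -
  have "norm ((\<integral>\<omega>. f \<omega> \<partial>M) - (\<integral>\<omega>. g \<omega> \<partial>M)) = norm (\<integral>\<omega>. f \<omega> - g \<omega> \<partial>M)"
    using assms by simp
  also have "\<dots> \<le> (\<integral>\<omega>. norm (f \<omega> - g \<omega>) \<partial>M)"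
    by (rule integral_norm_bound)
  also have "\<dots> \<le> (\<integral>\<omega>. \<eta> + B * indicator A \<omega> \<partial>M)"
  proof (rule integral_mono_AE)
    show "AE \<omega> in M. norm (f \<omega> - g \<omega>) \<le> \<eta> + B * indicator A \<omega>"
      using assms(4,5) by eventually_elim (use \<open>\<eta> \<ge> 0\<close> in \<open>auto simp: indicator_def\<close>)
  qed (use assms in \<open>auto intro!: integrable_real_indicator simp: emeasure_eq_measure\<close>)
  also have "\<dots> = \<eta> + B * measure M A"
    using \<open>A \<in> sets M\<close> by (subst Bochner_Integration.integral_add)
      (auto intro!: integrable_real_indicator simp: emeasure_eq_measure prob_space)
  finally show ?thesis .
qed

text \<open>
  Levy's continuity theorem in several dimensions, for a limit that is known to be the
  characteristic function of a probability law. Tightness confines the comparison to a ball, where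
  test functions are replaced by trigonometric polynomials.
\<close>
theorem conv_in_distribution_if_char_tendsto:
  fixes Z :: "nat \<Rightarrow> 'a \<Rightarrow> real^'q" and N :: "(real^'q) measure"
  assumes "prob_space M" "prob_space N" and sN: "sets N = sets borel"
    and Z: "\<And>n. Z n \<in> borel_measurable M"
    and char: "\<And>t. (\<lambda>n. \<integral>\<omega>. iexp (t \<bullet> Z n \<omega>) \<partial>M) \<longlonglongrightarrow> (\<integral>z. iexp (t \<bullet> z) \<partial>N)"
  shows "conv_in_distribution M Z N"
  unfolding conv_in_distribution_def
proof (intro allI impI)
  interpret M: prob_space M by fact
  interpret N: prob_space N by fact
  note [measurable_cong] = sN
  have [measurable]: "Z n \<in> borel_measurable M" for n by fact
  have id: "(\<lambda>z. z) \<in> borel_measurable N" by (simp add: measurable_ident_sets sN)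
  fix f :: "real^'q \<Rightarrow> real"
  assume f: "continuous_on UNIV f \<and> bounded (range f)"
  then have cf: "continuous_on UNIV f" by simp
  from f obtain B where "\<forall>x\<in>range f. norm x \<le> B" by (auto simp: bounded_iff)
  then have B: "\<bar>f x\<bar> \<le> B" for x by auto
  then have "B \<ge> 0" by (meson abs_ge_zero order_trans)
  show "(\<lambda>n. \<integral>\<omega>. f (Z n \<omega>) \<partial>M) \<longlonglongrightarrow> (\<integral>z. f z \<partial>N)"
  proof (rule tendstoI)
    fix \<epsilon> :: real assume "\<epsilon> > 0"
    define \<eta> where "\<eta> = min 1 (\<epsilon> / 5)"
    have \<eta>: "\<eta> > 0" "5 * \<eta> \<le> \<epsilon>" "\<eta> \<le> 1" using \<open>\<epsilon> > 0\<close> by (auto simp: \<eta>_def)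
    define \<delta> where "\<delta> = \<eta> / (2 * B + 1)"
    have \<delta>: "\<delta> > 0" "(2 * B + 1) * \<delta> = \<eta>" using \<eta> \<open>B \<ge> 0\<close> by (auto simp: \<delta>_def)
    obtain K1 where K1: "\<forall>\<^sub>F n in sequentially. measure M {\<omega>\<in>space M. norm (Z n \<omega>) > K1} < \<delta>"
      using tight_if_char_tendsto[OF assms \<delta>(1)] by blast
    obtain K2 where K2: "measure N {z\<in>space N. norm z > K2} < \<delta>"
      using tight_if_char_tendsto[OF \<open>prob_space N\<close> \<open>prob_space N\<close> sN id tendsto_const \<delta>(1)] by auto
    define K where "K = max 1 (max K1 K2)"
    have K: "K > 0" "K1 \<le> K" "K2 \<le> K" by (auto simp: K_def)
    obtain g where g: "trig_sum g" "\<And>x. \<bar>g x\<bar> \<le> B + \<eta>" "\<And>x. norm x \<le> K \<Longrightarrow> \<bar>f x - g x\<bar> \<le> \<eta>"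
      using trig_sum_approx[of f B K \<eta>] f B K \<eta> by blast
    have diff: "\<bar>f x - g x\<bar> \<le> 2 * B + 1" for x
      using B[of x] g(2)[of x] \<eta>(3) by linarith
    have cg: "continuous_on UNIV g" using trig_sum_bounded_continuous[OF g(1)] by blast
    have "\<bar>(\<integral>z. f z \<partial>N) - (\<integral>z. g z \<partial>N)\<bar> \<le> \<eta> + (2 * B + 1) * measure N {z\<in>space N. norm z > K}"
      using diff g(3) \<eta> N.integrable_bounded_continuous[OF id cg g(2)]
        N.integrable_bounded_continuous[OF id cf B]
      by (intro N.integral_diff_le_off_event[of f g, unfolded real_norm_def]) (auto simp: not_less)
    also have "measure N {z\<in>space N. norm z > K} \<le> measure N {z\<in>space N. norm z > K2}"
      using K by (intro N.finite_measure_mono) auto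
    finally have "\<bar>(\<integral>z. f z \<partial>N) - (\<integral>z. g z \<partial>N)\<bar> \<le> \<eta> + (2 * B + 1) * measure N {z\<in>space N. norm z > K2}"
      using \<open>B \<ge> 0\<close> by (simp add: mult_left_mono)
    also have "\<dots> \<le> \<eta> + (2 * B + 1) * \<delta>"
      using K2 \<open>B \<ge> 0\<close> by (intro add_left_mono mult_left_mono) auto
    finally have 1: "\<bar>(\<integral>z. f z \<partial>N) - (\<integral>z. g z \<partial>N)\<bar> \<le> 2 * \<eta>" using \<delta> by simp
    have "\<forall>\<^sub>F n in sequentially. \<bar>(\<integral>\<omega>. g (Z n \<omega>) \<partial>M) - (\<integral>z. g z \<partial>N)\<bar> < \<eta>"
      using tendstoD[OF integral_trig_sum_tendsto[OF assms g(1)] \<eta>(1)] by (simp add: dist_real_def)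
    with K1 show "\<forall>\<^sub>F n in sequentially. dist (\<integral>\<omega>. f (Z n \<omega>) \<partial>M) (\<integral>z. f z \<partial>N) < \<epsilon>"
    proof eventually_elim
      case (elim n)
      have "\<bar>(\<integral>\<omega>. f (Z n \<omega>) \<partial>M) - (\<integral>\<omega>. g (Z n \<omega>) \<partial>M)\<bar>
          \<le> \<eta> + (2 * B + 1) * measure M {\<omega>\<in>space M. norm (Z n \<omega>) > K}"
        using diff g(3) \<eta> M.integrable_bounded_continuous[OF Z cg g(2)]
          M.integrable_bounded_continuous[OF Z cf B]
        by (intro M.integral_diff_le_off_event[of "\<lambda>\<omega>. f (Z n \<omega>)" "\<lambda>\<omega>. g (Z n \<omega>)", unfolded real_norm_def])
           (auto simp: not_less)
      also have "measure M {\<omega>\<in>space M. norm (Z n \<omega>) > K} \<le> measure M {\<omega>\<in>space M. norm (Z n \<omega>) > K1}"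
        using K by (intro M.finite_measure_mono) auto
      also have "\<dots> \<le> \<delta>" using elim by simp
      finally have "\<bar>(\<integral>\<omega>. f (Z n \<omega>) \<partial>M) - (\<integral>\<omega>. g (Z n \<omega>) \<partial>M)\<bar> \<le> 2 * \<eta>"
        using \<delta> \<open>B \<ge> 0\<close> by (simp add: mult_left_mono)
      with 1 elim \<eta> show ?case unfolding dist_real_def by linarith
    qed
  qed
qed

section \<open>Weighted sums of independent errors under a random design\<close>

lemma abs_exp_minus_linear_le:
  fixes u :: real
  assumes "u \<ge> 0"
  shows "\<bar>exp (- u) - (1 - u)\<bar> \<le> u\<^sup>2"
proof -
  have "exp (- u) \<le> 1 / (1 + u)"
    using exp_ge_add_one_self[of u] assms by (simp add: exp_minus field_simps)
  also have "\<dots> \<le> 1 - u + u\<^sup>2"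
    using assms by (simp add: field_simps power2_eq_square)
  finally show ?thesis using exp_ge_add_one_self[of "- u"] by simp
qed

text \<open>
  A Taylor expansion to second order. Third moments may be infinite, so the remainder carries the truncation
  \<open>min (6 * x\<^sup>2) (\<bar>w\<bar> * \<bar>x\<bar> ^ 3)\<close>, whose expectation vanishes with \<open>w\<close> by dominated convergence.
\<close>
lemma (in real_distribution) char_close_to_gaussian:
  assumes "integrable M (\<lambda>x. x)" "expectation (\<lambda>x. x) = 0"
    and sq: "integrable M (\<lambda>x. x\<^sup>2)" and "variance (\<lambda>x. x) = \<sigma>\<^sup>2" and "\<eta> > 0"
  shows "\<exists>d>0. \<forall>w. \<bar>w\<bar> \<le> d \<longrightarrow> norm (char M w - exp (- (\<sigma>\<^sup>2 * w\<^sup>2 / 2))) \<le> \<eta> * w\<^sup>2"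
proof -
  define R where "R r = expectation (\<lambda>x. min (6 * x\<^sup>2) (r * \<bar>x\<bar> ^ 3))" for r
  have int: "integrable M (\<lambda>x. min (6 * x\<^sup>2) (r * \<bar>x\<bar> ^ 3))" if "r \<ge> 0" for r
    by (rule Bochner_Integration.integrable_bound[OF integrable_mult_right[OF sq, of 6]])
       (use that in auto)
  have "(\<lambda>k. R (1 / real (Suc k))) \<longlonglongrightarrow> expectation (\<lambda>x. 0)"
    unfolding R_def
  proof (rule integral_dominated_convergence[where w = "\<lambda>x. 6 * x\<^sup>2"])
    show "AE x in M. (\<lambda>k. min (6 * x\<^sup>2) (1 / real (Suc k) * \<bar>x\<bar> ^ 3)) \<longlonglongrightarrow> 0"
    proof (rule AE_I2)
      fix x :: real
      have "(\<lambda>k. min (6 * x\<^sup>2) (1 / real (Suc k) * \<bar>x\<bar> ^ 3)) \<longlonglongrightarrow> min (6 * x\<^sup>2) (0 * \<bar>x\<bar> ^ 3)"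
        by (intro tendsto_intros lim_1_over_n LIMSEQ_Suc[OF lim_1_over_n])
      moreover have "min (6 * x\<^sup>2) (0 * \<bar>x\<bar> ^ 3) = 0" by simp
      ultimately show "(\<lambda>k. min (6 * x\<^sup>2) (1 / real (Suc k) * \<bar>x\<bar> ^ 3)) \<longlonglongrightarrow> 0"
        by (simp only:)
    qed
  qed (use sq in auto)
  then have "(\<lambda>k. R (1 / real (Suc k))) \<longlonglongrightarrow> 0" by simp
  then have "\<forall>\<^sub>F k in sequentially. R (1 / real (Suc k)) < \<eta>"
    using \<open>\<eta> > 0\<close> by (rule order_tendstoD(2))
  then obtain k where k: "R (1 / real (Suc k)) < \<eta>"
    by (auto simp: eventually_sequentially)
  \<comment> \<open>the second entry makes the quadratic error of \<open>exp (- u)\<close> at \<open>u = \<sigma>\<^sup>2 * w\<^sup>2 / 2\<close> at most \<open>\<eta> * w\<^sup>2 / 4\<close>\<close>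
  define d where "d = min (1 / real (Suc k)) (sqrt \<eta> / (\<sigma>\<^sup>2 + 1))"
  have "d > 0" using \<open>\<eta> > 0\<close> by (auto simp: d_def add_nonneg_pos)
  moreover have "norm (char M w - exp (- (\<sigma>\<^sup>2 * w\<^sup>2 / 2))) \<le> \<eta> * w\<^sup>2" if w: "\<bar>w\<bar> \<le> d" for w
  proof -
    let ?u = "\<sigma>\<^sup>2 * w\<^sup>2 / 2"
    have "norm (char M w - (1 - w\<^sup>2 * \<sigma>\<^sup>2 / 2)) \<le> (w\<^sup>2 / 6) * R \<bar>w\<bar>"
      unfolding R_def by (rule char_approx3) fact+
    also have "R \<bar>w\<bar> \<le> R (1 / real (Suc k))"
      unfolding R_def
    proof (rule integral_mono[OF int int])
      have "\<bar>w\<bar> \<le> 1 / real (Suc k)" using w by (simp add: d_def)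
      then show "min (6 * x\<^sup>2) (\<bar>w\<bar> * \<bar>x\<bar> ^ 3) \<le> min (6 * x\<^sup>2) (1 / real (Suc k) * \<bar>x\<bar> ^ 3)" for x
        by (intro min.mono mult_right_mono) auto
    qed auto
    also have "\<dots> \<le> \<eta>" using k by simp
    finally have "norm (char M w - (1 - w\<^sup>2 * \<sigma>\<^sup>2 / 2)) \<le> w\<^sup>2 / 6 * \<eta>"
      by (simp add: mult_left_mono)
    then have 1: "norm (char M w - complex_of_real (1 - ?u)) \<le> w\<^sup>2 / 6 * \<eta>"
      by (simp only: mult.commute)
    have "\<bar>w\<bar> * (\<sigma>\<^sup>2 + 1) \<le> sqrt \<eta>"
      using w by (simp add: d_def pos_le_divide_eq add_nonneg_pos)
    then have "(\<bar>w\<bar> * (\<sigma>\<^sup>2 + 1))\<^sup>2 \<le> \<eta>"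
      using \<open>\<eta> > 0\<close> by (metis abs_ge_zero less_imp_le mult_nonneg_nonneg add_nonneg_nonneg power_mono real_sqrt_pow2 zero_le_one zero_le_power2)
    moreover have "w\<^sup>2 * (\<sigma>\<^sup>2)\<^sup>2 \<le> (\<bar>w\<bar> * (\<sigma>\<^sup>2 + 1))\<^sup>2"
      unfolding power_mult_distrib power2_abs by (intro mult_left_mono power_mono) auto
    ultimately have "w\<^sup>2 * (\<sigma>\<^sup>2)\<^sup>2 \<le> \<eta>" by linarith
    then have "w\<^sup>2 * (w\<^sup>2 * (\<sigma>\<^sup>2)\<^sup>2) \<le> w\<^sup>2 * \<eta>" by (intro mult_left_mono) auto
    then have "?u\<^sup>2 \<le> w\<^sup>2 / 4 * \<eta>" by (simp add: power2_eq_square algebra_simps)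
    then have "\<bar>exp (- ?u) - (1 - ?u)\<bar> \<le> w\<^sup>2 / 4 * \<eta>"
      using abs_exp_minus_linear_le[of ?u] by simp
    then have 2: "norm (complex_of_real (1 - ?u) - complex_of_real (exp (- ?u))) \<le> w\<^sup>2 / 4 * \<eta>"
      unfolding of_real_diff[symmetric] norm_of_real by linarith
    have "norm (char M w - exp (- ?u)) \<le> w\<^sup>2 / 6 * \<eta> + w\<^sup>2 / 4 * \<eta>"
      using norm_triangle_le[OF add_mono[OF 1 2]] by simp
    also have "\<dots> \<le> \<eta> * w\<^sup>2"
      using \<open>\<eta> > 0\<close> by (simp add: field_simps)
    finally show ?thesis .
  qed
  ultimately show ?thesis by blast
qed

text \<open>
  Lindeberg's central limit theorem for weighted sums of identically distributed variables, in
  terms of characteristic functions. Weights that are uniformly small and have convergent sums of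
  squares are enough, because replacing one factor by its Gaussian counterpart costs at most
  \<open>\<eta> * (w n i)\<^sup>2\<close>.
\<close>
lemma (in real_distribution) prod_char_tendsto_gaussian:
  fixes w :: "nat \<Rightarrow> nat \<Rightarrow> real"
  assumes moments: "integrable M (\<lambda>x. x)" "expectation (\<lambda>x. x) = 0"
      "integrable M (\<lambda>x. x\<^sup>2)" "variance (\<lambda>x. x) = \<sigma>\<^sup>2"
    and v: "(\<lambda>n. \<Sum>i<n. (w n i)\<^sup>2) \<longlonglongrightarrow> v"
    and negligible: "\<And>d. d > 0 \<Longrightarrow> \<forall>\<^sub>F n in sequentially. \<forall>i<n. \<bar>w n i\<bar> \<le> d"
  shows "(\<lambda>n. \<Prod>i<n. char M (w n i)) \<longlonglongrightarrow> complex_of_real (exp (- (\<sigma>\<^sup>2 * v / 2)))"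
proof -
  have "v \<ge> 0" by (rule LIMSEQ_le_const[OF v]) (auto intro!: exI[of _ 0] sum_nonneg)
  define G where "G n = complex_of_real (exp (- (\<sigma>\<^sup>2 * (\<Sum>i<n. (w n i)\<^sup>2) / 2)))" for n
  have G: "G n = (\<Prod>i<n. complex_of_real (exp (- (\<sigma>\<^sup>2 * (w n i)\<^sup>2 / 2))))" for n
  proof -
    have "- (\<sigma>\<^sup>2 * (\<Sum>i<n. (w n i)\<^sup>2) / 2) = (\<Sum>i<n. - (\<sigma>\<^sup>2 * (w n i)\<^sup>2 / 2))"
      by (simp add: sum_distrib_left sum_divide_distrib sum_negf)
    then show ?thesis unfolding G_def by (simp only: exp_sum finite_lessThan of_real_prod)
  qed
  have "(\<lambda>n. (\<Prod>i<n. char M (w n i)) - G n) \<longlonglongrightarrow> 0"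
  proof (rule tendstoI)
    fix \<epsilon> :: real assume "\<epsilon> > 0"
    define \<eta> where "\<eta> = \<epsilon> / (v + 2)"
    have \<eta>: "\<eta> > 0" "\<eta> * (v + 1) < \<epsilon>" using \<open>\<epsilon> > 0\<close> \<open>v \<ge> 0\<close> by (auto simp: \<eta>_def field_simps)
    obtain d where d: "d > 0"
        "\<And>w. \<bar>w\<bar> \<le> d \<Longrightarrow> norm (char M w - exp (- (\<sigma>\<^sup>2 * w\<^sup>2 / 2))) \<le> \<eta> * w\<^sup>2"
      using char_close_to_gaussian[OF moments \<eta>(1)] by blast
    have "\<forall>\<^sub>F n in sequentially. (\<Sum>i<n. (w n i)\<^sup>2) < v + 1"
      by (rule order_tendstoD(2)[OF v]) simp
    with negligible[OF d(1)]
    show "\<forall>\<^sub>F n in sequentially. dist ((\<Prod>i<n. char M (w n i)) - G n) 0 < \<epsilon>"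
    proof eventually_elim
      case (elim n)
      have "norm ((\<Prod>i<n. char M (w n i)) - G n)
          \<le> (\<Sum>i<n. norm (char M (w n i) - exp (- (\<sigma>\<^sup>2 * (w n i)\<^sup>2 / 2))))"
        unfolding G by (rule norm_prod_diff) (auto simp: cmod_char_le_1)
      also have "\<dots> \<le> (\<Sum>i<n. \<eta> * (w n i)\<^sup>2)"
        using elim(1) d(2) by (intro sum_mono) auto
      also have "\<dots> \<le> \<eta> * (v + 1)"
        unfolding sum_distrib_left[symmetric] using elim(2) \<eta>(1) by (intro mult_left_mono) auto
      also have "\<dots> < \<epsilon>" by fact
      finally show ?case by simp
    qed
  qed
  moreover have "G \<longlonglongrightarrow> complex_of_real (exp (- (\<sigma>\<^sup>2 * v / 2)))"
    unfolding G_def by (intro tendsto_intros v) simp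
  ultimately show ?thesis by (rule Lim_transform[rotated])
qed

text \<open>
  This provides the uniform smallness of the weights: if the averages of \<open>f\<close> converge, then
  \<open>f n / n\<close>, a difference of consecutive averages up to the factor \<open>1 + 1 / n\<close>, tends to \<open>0\<close>;
  an early index \<open>i\<close> is handled by the division by \<open>n\<close> alone.
\<close>
lemma summands_negligible_if_averages_converge:
  fixes f :: "nat \<Rightarrow> real"
  assumes nonneg: "\<And>i. f i \<ge> 0" and lim: "(\<lambda>n. (\<Sum>i<n. f i) / real n) \<longlonglongrightarrow> l" and "\<delta> > 0"
  shows "\<forall>\<^sub>F n in sequentially. \<forall>i<n. f i / real n \<le> \<delta>"
proof -
  define S where "S n = (\<Sum>i<n. f i) / real n" for n
  have "(\<lambda>n. (1 + 1 / real n) * S (Suc n) - S n) \<longlonglongrightarrow> (1 + 0) * l - l"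
    using lim by (intro tendsto_intros lim_1_over_n LIMSEQ_Suc) (auto simp: S_def[abs_def])
  then have "(\<lambda>n. (1 + 1 / real n) * S (Suc n) - S n) \<longlonglongrightarrow> 0" by simp
  then have "\<forall>\<^sub>F n in sequentially. (1 + 1 / real n) * S (Suc n) - S n < \<delta>"
    using \<open>\<delta> > 0\<close> by (rule order_tendstoD(2))
  then obtain n0 where n0: "\<And>n. n \<ge> n0 \<Longrightarrow> (1 + 1 / real n) * S (Suc n) - S n < \<delta>"
    by (auto simp: eventually_sequentially)
  have late: "f n \<le> \<delta> * real n" if "n \<ge> n0" "n > 0" for n
  proof -
    have "(1 + 1 / real n) * S (Suc n) = (\<Sum>i<Suc n. f i) / real n"
    proof -
      have "1 + 1 / real n = real (Suc n) / real n" using that by (simp add: field_simps)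
      then show ?thesis by (simp add: S_def)
    qed
    then have "(1 + 1 / real n) * S (Suc n) - S n = f n / real n"
      by (simp add: S_def add_divide_distrib)
    then show ?thesis using n0[OF that(1)] that by (simp add: field_simps)
  qed
  have "(\<lambda>n. Max (insert 0 (f ` {..n0})) / real n) \<longlonglongrightarrow> 0"
    by (rule tendsto_divide_0[OF tendsto_const]) (rule filterlim_real_sequentially[THEN filterlim_at_top_imp_at_infinity])
  then have "\<forall>\<^sub>F n in sequentially. Max (insert 0 (f ` {..n0})) / real n < \<delta>"
    using \<open>\<delta> > 0\<close> by (rule order_tendstoD(2))
  then show ?thesis
  proof (rule eventually_elim2[OF _ eventually_gt_at_top[of 0]], intro allI impI)
    fix n i :: nat assume n: "Max (insert 0 (f ` {..n0})) / real n < \<delta>" "n > 0" and "i < n"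
    show "f i / real n \<le> \<delta>"
    proof (cases "i \<le> n0")
      case True
      then have "f i \<le> Max (insert 0 (f ` {..n0}))" by (intro Max_ge) auto
      then have "f i / real n \<le> Max (insert 0 (f ` {..n0})) / real n" by (intro divide_right_mono) auto
      with n show ?thesis by linarith
    next
      case False
      then have "f i \<le> \<delta> * real i" by (intro late) auto
      also have "\<dots> \<le> \<delta> * real n" using \<open>i < n\<close> \<open>\<delta> > 0\<close> by simp
      finally show ?thesis using n by (simp add: field_simps)
    qed
  qed
qed

text \<open>
  Independence is expressed by the generated \<open>\<sigma>\<close>-algebras because \<open>indep_var\<close> relates variables of one
  type, while the sequences of predictors and of errors have different types.
\<close>
lemma (in prob_space) distr_pair_if_indep_set:
  assumes X[measurable]: "X \<in> measurable M S" and Y[measurable]: "Y \<in> measurable M T"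
    and indep: "indep_set (sets (vimage_algebra (space M) X S)) (sets (vimage_algebra (space M) Y T))"
  shows "distr M S X \<Otimes>\<^sub>M distr M T Y = distr M (S \<Otimes>\<^sub>M T) (\<lambda>\<omega>. (X \<omega>, Y \<omega>))"
proof (rule pair_measure_eqI)
  interpret PX: prob_space "distr M S X" by (rule prob_space_distr) simp
  interpret PY: prob_space "distr M T Y" by (rule prob_space_distr) simp
  show "sigma_finite_measure (distr M S X)" "sigma_finite_measure (distr M T Y)" by unfold_locales
  fix A B assume "A \<in> sets (distr M S X)" "B \<in> sets (distr M T Y)"
  then have [measurable]: "A \<in> sets S" "B \<in> sets T" by simp_all
  have "prob ((X -` A \<inter> space M) \<inter> (Y -` B \<inter> space M)) = prob (X -` A \<inter> space M) * prob (Y -` B \<inter> space M)"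
    by (rule indep_setD[OF indep]) (auto intro: in_vimage_algebra)
  moreover have "(\<lambda>\<omega>. (X \<omega>, Y \<omega>)) -` (A \<times> B) \<inter> space M = (X -` A \<inter> space M) \<inter> (Y -` B \<inter> space M)"
    by auto
  ultimately show "emeasure (distr M S X) A * emeasure (distr M T Y) B =
      emeasure (distr M (S \<Otimes>\<^sub>M T) (\<lambda>\<omega>. (X \<omega>, Y \<omega>))) (A \<times> B)"
    by (simp add: emeasure_distr emeasure_eq_measure ennreal_mult)
qed simp

text \<open>
  Conditioning on the design: with the weights frozen at a value of \<open>X\<close>, the characteristic function
  of the weighted sum factorizes, and Fubini's theorem averages the product over \<open>X\<close>.
\<close>
lemma (in prob_space) char_weighted_sum_random_weights:
  fixes \<epsilon> :: "nat \<Rightarrow> 'a \<Rightarrow> real" and X :: "'a \<Rightarrow> 'b" and w :: "nat \<Rightarrow> 'b \<Rightarrow> real"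
  assumes indep: "indep_vars (\<lambda>_. borel) \<epsilon> UNIV" and ident: "\<And>i. distr M borel (\<epsilon> i) = \<mu>"
    and X: "X \<in> measurable M S"
    and XE: "indep_set (sets (vimage_algebra (space M) X S))
      (sets (vimage_algebra (space M) (\<lambda>\<omega> i. \<epsilon> i \<omega>) (Pi\<^sub>M UNIV (\<lambda>_. borel))))"
    and w: "\<And>i. w i \<in> borel_measurable S"
  shows "(\<integral>\<omega>. iexp (\<Sum>i<n. w i (X \<omega>) * \<epsilon> i \<omega>) \<partial>M) = (\<integral>\<omega>. (\<Prod>i<n. char \<mu> (w i (X \<omega>))) \<partial>M)"
proof -
  define T where "T = (Pi\<^sub>M UNIV (\<lambda>_. borel) :: (nat \<Rightarrow> real) measure)"
  define E where "E \<omega> = (\<lambda>i. \<epsilon> i \<omega>)" for \<omega>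
  define F where "F = (\<lambda>(x, e). iexp (\<Sum>i<n. w i x * e i))" 
  note [measurable] = w
  have [measurable]: "\<epsilon> i \<in> borel_measurable M" for i
    using indep by (auto simp: indep_vars_def)
  interpret \<mu>: real_distribution \<mu>
    unfolding ident[of 0, symmetric] by (rule real_distribution_distr) simp
  have rv[measurable]: "X \<in> measurable M S" "E \<in> measurable M T"
    using X unfolding T_def E_def by (auto intro!: measurable_PiM_single')
  have joint: "distr M S X \<Otimes>\<^sub>M distr M T E = distr M (S \<Otimes>\<^sub>M T) (\<lambda>\<omega>. (X \<omega>, E \<omega>))"
    using distr_pair_if_indep_set[OF rv] XE by (simp add: T_def E_def[abs_def])
  interpret PX: prob_space "distr M S X" by (rule prob_space_distr) simp
  interpret PE: prob_space "distr M T E" by (rule prob_space_distr) simp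
  interpret P: pair_prob_space "distr M S X" "distr M T E" ..
  have [measurable]: "(\<lambda>e. e i) \<in> borel_measurable T" for i by (simp add: T_def)
  have F[measurable]: "F \<in> borel_measurable (S \<Otimes>\<^sub>M T)" unfolding F_def by measurable
  have inner: "(\<integral>e. F (x, e) \<partial>distr M T E) = (\<Prod>i<n. char \<mu> (w i x))" if "x \<in> space S" for x
  proof -
    have [measurable]: "(\<lambda>e. F (x, e)) \<in> borel_measurable T" using that by simp
    have "(\<integral>e. F (x, e) \<partial>distr M T E) = (\<integral>\<omega>. iexp (\<Sum>i<n. w i x * \<epsilon> i \<omega>) \<partial>M)"
      by (subst integral_distr) (simp_all add: F_def E_def)
    also have "\<dots> = char (distr M borel (\<lambda>\<omega>. \<Sum>i<n. w i x * \<epsilon> i \<omega>)) 1"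
      unfolding char_def by (subst integral_distr) simp_all
    also have "\<dots> = (\<Prod>i<n. char (distr M borel (\<lambda>\<omega>. w i x * \<epsilon> i \<omega>)) 1)"
      by (intro char_distr_sum indep_vars_compose2[where Y = "\<lambda>i e. w i x * e", OF indep_vars_subset[OF indep]]) auto
    also have "\<dots> = (\<Prod>i<n. char \<mu> (w i x))"
    proof (rule prod.cong[OF refl])
      show "char (distr M borel (\<lambda>\<omega>. w i x * \<epsilon> i \<omega>)) 1 = char \<mu> (w i x)" for i
        unfolding char_def ident[of i, symmetric] by (subst (1 2) integral_distr) simp_all
    qed
    finally show ?thesis .
  qed
  have "(\<integral>\<omega>. iexp (\<Sum>i<n. w i (X \<omega>) * \<epsilon> i \<omega>) \<partial>M) = (\<integral>z. F z \<partial>(distr M S X \<Otimes>\<^sub>M distr M T E))"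
  proof -
    have [measurable]: "(\<lambda>\<omega>. (X \<omega>, E \<omega>)) \<in> measurable M (S \<Otimes>\<^sub>M T)" by measurable
    have "(\<integral>z. F z \<partial>(distr M S X \<Otimes>\<^sub>M distr M T E)) = (\<integral>\<omega>. F (X \<omega>, E \<omega>) \<partial>M)"
      unfolding joint by (subst integral_distr) simp_all
    then show ?thesis by (simp add: F_def E_def)
  qed
  also have "\<dots> = (\<integral>x. (\<integral>e. F (x, e) \<partial>distr M T E) \<partial>distr M S X)"
  proof (rule P.integral_fst'[symmetric], rule P.integrable_const_bound[where B = 1])
    show "F \<in> borel_measurable (distr M S X \<Otimes>\<^sub>M distr M T E)"
      unfolding joint by simp
  qed (auto simp: F_def)
  also have "\<dots> = (\<integral>x. (\<Prod>i<n. char \<mu> (w i x)) \<partial>distr M S X)"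
    by (intro Bochner_Integration.integral_cong refl inner) simp
  also have "\<dots> = (\<integral>\<omega>. (\<Prod>i<n. char \<mu> (w i (X \<omega>))) \<partial>M)"
    by (subst integral_distr) simp_all
  finally show ?thesis .
qed

text \<open>
  The gradient of the log-likelihood of Gaussian errors at the true parameter, up to the factor
  \<open>\<sigma>\<^sup>2\<close> and divided by \<open>sqrt n\<close>; the minimization problems depend on the errors, up to additive constants, through it alone.
\<close>
definition score :: "nat \<Rightarrow> (nat \<Rightarrow> real^'p) \<Rightarrow> (nat \<Rightarrow> real) \<Rightarrow> real^'p" where
  "score n x \<epsilon> = (1 / sqrt (real n)) *\<^sub>R (\<Sum>i<n. \<epsilon> i *\<^sub>R x i)"

lemma tendsto_matrix_vector_mult:
  fixes A :: "'b \<Rightarrow> real^'n^'m"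
  assumes "(A \<longlongrightarrow> B) F"
  shows "((\<lambda>x. A x *v t) \<longlongrightarrow> B *v t) F"
  unfolding matrix_vector_mult_def
  by (intro vec_tendstoI) (simp, intro tendsto_intros assms)

lemma inner_gram: "t \<bullet> (gram n x *v t) = (\<Sum>i<n. (t \<bullet> x i)\<^sup>2)"
proof -
  have "t \<bullet> (gram n x *v t) = (\<Sum>j\<in>UNIV. \<Sum>k\<in>UNIV. \<Sum>i<n. (t $ j * x i $ j) * (t $ k * x i $ k))"
    by (simp add: inner_vec_def matrix_vector_mult_def gram_def sum_distrib_left sum_distrib_right
          mult_ac)
  also have "\<dots> = (\<Sum>j\<in>UNIV. \<Sum>i<n. \<Sum>k\<in>UNIV. (t $ j * x i $ j) * (t $ k * x i $ k))"
    by (intro sum.cong refl sum.swap)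
  also have "\<dots> = (\<Sum>i<n. \<Sum>j\<in>UNIV. \<Sum>k\<in>UNIV. (t $ j * x i $ j) * (t $ k * x i $ k))"
    by (rule sum.swap)
  also have "\<dots> = (\<Sum>i<n. (t \<bullet> x i)\<^sup>2)"
    by (simp add: power2_eq_square inner_vec_def sum_product)
  finally show ?thesis .
qed

text \<open>
  Given the design, the score in direction \<open>t\<close> is a weighted sum of the errors whose squared weights
  add up to \<open>t \<bullet> (G *v t)\<close> for the scaled Gram matrix \<open>G\<close>. This converges for almost every design,
  so the conditional characteristic functions converge almost surely; they are bounded by \<open>1\<close>, so their
  expectations converge too.
\<close>
lemma char_score_tendsto:
  fixes x :: "nat \<Rightarrow> 'a \<Rightarrow> real^'p"
  assumes model: "linear_model M x \<epsilon> y \<beta>\<^sub>0 \<sigma>"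
    and gram: "AE \<omega> in M. (\<lambda>n. (1 / real n) *\<^sub>R gram n (\<lambda>i. x i \<omega>)) \<longlonglongrightarrow> C"
  shows "(\<lambda>n. \<integral>\<omega>. iexp (t \<bullet> score n (\<lambda>i. x i \<omega>) (\<lambda>i. \<epsilon> i \<omega>)) \<partial>M)
           \<longlonglongrightarrow> complex_of_real (exp (- (\<sigma>\<^sup>2 * (t \<bullet> (C *v t)) / 2)))"
proof -
  interpret prob_space M using model by (simp add: linear_model_def)
  define \<mu> where "\<mu> = distr M borel (\<epsilon> 0)"
  have indep: "indep_vars (\<lambda>_. borel) \<epsilon> UNIV" and ident: "distr M borel (\<epsilon> i) = \<mu>" for i
    using model unfolding linear_model_def \<mu>_def by blast+
  have mom: "integrable M (\<epsilon> 0)" "expectation (\<epsilon> 0) = 0"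
      "integrable M (\<lambda>\<omega>. (\<epsilon> 0 \<omega>)\<^sup>2)" "variance (\<epsilon> 0) = \<sigma>\<^sup>2"
    using model unfolding linear_model_def by blast+
  have [measurable]: "\<epsilon> i \<in> borel_measurable M" for i
    using indep by (auto simp: indep_vars_def)
  have [measurable]: "x i \<in> borel_measurable M" for i
    using model unfolding linear_model_def by blast
  define S where "S = (Pi\<^sub>M UNIV (\<lambda>_. borel) :: (nat \<Rightarrow> real^'p) measure)"
  define X where "X \<omega> = (\<lambda>i. x i \<omega>)" for \<omega>
  have X[measurable]: "X \<in> measurable M S" unfolding X_def S_def by (rule measurable_PiM_single') auto
  have XE: "indep_set (sets (vimage_algebra (space M) X S))
      (sets (vimage_algebra (space M) (\<lambda>\<omega> i. \<epsilon> i \<omega>) (Pi\<^sub>M UNIV (\<lambda>_. borel))))"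
    using model by (simp add: linear_model_def X_def[abs_def] S_def)
  interpret \<mu>: real_distribution \<mu>
    unfolding \<mu>_def by (rule real_distribution_distr) simp
  have mom': "integrable \<mu> (\<lambda>x. x)" "\<mu>.expectation (\<lambda>x. x) = 0"
      "integrable \<mu> (\<lambda>x. x\<^sup>2)" "\<mu>.variance (\<lambda>x. x) = \<sigma>\<^sup>2"
    using mom by (simp_all add: \<mu>_def integrable_distr_eq integral_distr)
  define w where "w n i \<xi> = (t \<bullet> \<xi> i) / sqrt (real n)" for n i and \<xi> :: "nat \<Rightarrow> real^'p"
  have [measurable]: "w n i \<in> borel_measurable S" for n i
    unfolding w_def S_def by measurable
  have [measurable]: "(\<lambda>\<omega>. w n i (X \<omega>)) \<in> borel_measurable M" for n i by measurable
  have "(\<integral>\<omega>. iexp (t \<bullet> score n (\<lambda>i. x i \<omega>) (\<lambda>i. \<epsilon> i \<omega>)) \<partial>M) =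
        (\<integral>\<omega>. (\<Prod>i<n. char \<mu> (w n i (X \<omega>))) \<partial>M)" for n
  proof -
    have "t \<bullet> score n (\<lambda>i. x i \<omega>) (\<lambda>i. \<epsilon> i \<omega>) = (\<Sum>i<n. w n i (X \<omega>) * \<epsilon> i \<omega>)" for \<omega>
      by (simp add: score_def w_def X_def inner_sum_right sum_divide_distrib mult.commute)
    then show ?thesis
      using char_weighted_sum_random_weights[OF indep ident X XE, of "w n" n] by simp
  qed
  moreover have "(\<lambda>n. \<integral>\<omega>. (\<Prod>i<n. char \<mu> (w n i (X \<omega>))) \<partial>M)
      \<longlonglongrightarrow> (\<integral>\<omega>. complex_of_real (exp (- (\<sigma>\<^sup>2 * (t \<bullet> (C *v t)) / 2))) \<partial>M)"
  proof (rule integral_dominated_convergence[where w = "\<lambda>_. 1"])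
    show "AE \<omega> in M. (\<lambda>n. \<Prod>i<n. char \<mu> (w n i (X \<omega>)))
        \<longlonglongrightarrow> complex_of_real (exp (- (\<sigma>\<^sup>2 * (t \<bullet> (C *v t)) / 2)))"
      using gram
    proof eventually_elim
      case (elim \<omega>)
      have "(\<lambda>n. t \<bullet> (((1 / real n) *\<^sub>R gram n (\<lambda>i. x i \<omega>)) *v t)) \<longlonglongrightarrow> t \<bullet> (C *v t)"
        using elim by (intro tendsto_inner tendsto_const tendsto_matrix_vector_mult)
      then have v: "(\<lambda>n. (\<Sum>i<n. (t \<bullet> x i \<omega>)\<^sup>2) / real n) \<longlonglongrightarrow> t \<bullet> (C *v t)"
        by (simp add: scaleR_matrix_vector_assoc[symmetric] inner_gram)
      show ?case
      proof (rule \<mu>.prod_char_tendsto_gaussian[OF mom'])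
        show "(\<lambda>n. \<Sum>i<n. (w n i (X \<omega>))\<^sup>2) \<longlonglongrightarrow> t \<bullet> (C *v t)"
          using v by (simp add: w_def X_def power_divide sum_divide_distrib)
        show "\<forall>\<^sub>F n in sequentially. \<forall>i<n. \<bar>w n i (X \<omega>)\<bar> \<le> d" if "d > 0" for d
        proof -
          have "\<forall>\<^sub>F n in sequentially. \<forall>i<n. (t \<bullet> x i \<omega>)\<^sup>2 / real n \<le> d\<^sup>2"
            using summands_negligible_if_averages_converge[OF _ v, of "d\<^sup>2"] that by simp
          then show ?thesis
          proof eventually_elim
            case (elim n)
            have "\<bar>w n i (X \<omega>)\<bar>\<^sup>2 \<le> d\<^sup>2" if "i < n" for i
              using elim that by (simp add: w_def X_def power_divide)
            then show ?case using \<open>d > 0\<close> by (auto intro: power2_le_imp_le)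
          qed
        qed
      qed
    qed
    show "AE \<omega> in M. norm (\<Prod>i<n. char \<mu> (w n i (X \<omega>))) \<le> 1" for n
      by (intro AE_I2) (auto simp: prod_norm[symmetric] intro!: prod_le_1 \<mu>.cmod_char_le_1)
    show "(\<lambda>\<omega>. \<Prod>i<n. char \<mu> (w n i (X \<omega>))) \<in> borel_measurable M" for n
      by (intro borel_measurable_prod measurable_compose[OF _ \<mu>.char_measurable]) measurable
  qed auto
  ultimately show ?thesis by (simp add: prob_space)
qed

section \<open>Normal laws and roots of positive definite matrices\<close>

lemma inner_matrix_vector_mult: "x \<bullet> (A *v y) = (transpose A *v x) \<bullet> (y :: real^'n)"
  for A :: "real^'n^'m"
  by (metis dot_lmul_matrix inner_commute transpose_matrix_vector transpose_transpose)

text \<open>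
  Gram-Schmidt for the inner product \<open>x \<bullet> (C *v y)\<close>: fewer than \<open>CARD('n)\<close> vectors do not span, so
  there is a vector outside the span, which is made orthogonal to the family and normalized.
\<close>
lemma pos_definite_orthonormal_family:
  fixes C :: "real^'n^'n" and J :: "'n set"
  assumes C: "pos_definite C"
  shows "\<exists>v :: 'n \<Rightarrow> real^'n. \<forall>i\<in>J. \<forall>j\<in>J. v i \<bullet> (C *v v j) = of_bool (i = j)"
proof -
  have sym: "x \<bullet> (C *v y) = y \<bullet> (C *v x)" for x y
    using C inner_matrix_vector_mult[of x C y] by (simp add: pos_definite_def inner_commute)
  have pos: "x \<noteq> 0 \<Longrightarrow> x \<bullet> (C *v x) > 0" for x
    using C by (simp add: pos_definite_def)
  have "finite J" by simp
  then show ?thesis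
  proof (induction J)
    case empty
    show ?case by simp
  next
    case (insert a J)
    then obtain v :: "'n \<Rightarrow> real^'n" where v: "\<And>i j. i \<in> J \<Longrightarrow> j \<in> J \<Longrightarrow> v i \<bullet> (C *v v j) = of_bool (i = j)"
      by blast
    have "dim (span (v ` J)) \<le> card (v ` J)" by (simp add: dim_le_card')
    also have "\<dots> \<le> card J" by (simp add: card_image_le)
    also have "\<dots> < card (insert a J)" using insert.hyps by simp
    also have "\<dots> \<le> CARD('n)" by (intro card_mono) auto
    finally have "span (v ` J) \<noteq> (UNIV :: (real^'n) set)"
      by (metis DIM_cart DIM_real dim_UNIV less_irrefl mult.right_neutral)
    then obtain z where z: "z \<notin> span (v ` J)" by blast
    define u where "u = z - (\<Sum>i\<in>J. (z \<bullet> (C *v v i)) *\<^sub>R v i)"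
    have orth: "u \<bullet> (C *v v j) = 0" if "j \<in> J" for j
    proof -
      have "u \<bullet> (C *v v j) = z \<bullet> (C *v v j) - (\<Sum>i\<in>J. (z \<bullet> (C *v v i)) * of_bool (i = j))"
        using v that by (simp add: u_def inner_diff_left inner_sum_left)
      also have "\<dots> = 0" using that by (simp add: of_bool_def if_distrib cong: if_cong)
      finally show ?thesis .
    qed
    have "u \<noteq> 0"
    proof
      assume "u = 0"
      then have "z = (\<Sum>i\<in>J. (z \<bullet> (C *v v i)) *\<^sub>R v i)" by (simp add: u_def)
      also have "\<dots> \<in> span (v ` J)" by (intro span_sum span_scale span_base) auto
      finally show False using z by simp
    qed
    define r where "r = sqrt (u \<bullet> (C *v u))"
    have r: "r > 0" "r * r = u \<bullet> (C *v u)" using pos[OF \<open>u \<noteq> 0\<close>] by (auto simp: r_def)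
    define v' where "v' = v(a := (1 / r) *\<^sub>R u)"
    have "v' i \<bullet> (C *v v' j) = of_bool (i = j)" if "i \<in> insert a J" "j \<in> insert a J" for i j
      using that v orth r insert.hyps sym[of "v i" u]
      by (auto simp: v'_def matrix_vector_mult_scaleR field_simps)
    then show ?case by blast
  qed
qed

text \<open>
  A basis \<open>V\<close> that is orthonormal for \<open>C\<close> satisfies \<open>V\<^sup>T C V = 1\<close>, that is \<open>V V\<^sup>T\<close> is the inverse of \<open>C\<close>. Such a
  factorization is what makes the choice of a root in \<open>multi_normal\<close> meaningful.
\<close>
lemma pos_definite_inverse_factorization:
  fixes C :: "real^'n^'n"
  assumes C: "pos_definite C"
  obtains V :: "real^'n^'n" where "(V ** transpose V) ** C = mat 1" "C ** (V ** transpose V) = mat 1"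
proof -
  obtain v :: "'n \<Rightarrow> real^'n" where v: "\<And>i j. v i \<bullet> (C *v v j) = of_bool (i = j)"
    using pos_definite_orthonormal_family[OF C, of UNIV] by blast
  define V :: "real^'n^'n" where "V = (\<chi> k j. v j $ k)"
  have "(transpose V ** (C ** V)) $ i $ j = v i \<bullet> (C *v v j)" for i j
    by (simp add: V_def transpose_def matrix_matrix_mult_def inner_vec_def matrix_vector_mult_def)
  then have "transpose V ** (C ** V) = mat 1"
    by (simp add: vec_eq_iff v mat_def of_bool_def)
  then have "(transpose V ** C) ** V = mat 1" by (simp add: matrix_mul_assoc)
  then have "V ** (transpose V ** C) = mat 1" by (simp add: matrix_left_right_inverse)
  then have "(V ** transpose V) ** C = mat 1" by (simp add: matrix_mul_assoc)
  moreover from this have "C ** (V ** transpose V) = mat 1" by (simp add: matrix_left_right_inverse)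
  ultimately show thesis by (rule that)
qed

lemma matrix_inv_eqI:
  fixes A :: "real^'n^'n"
  assumes "B ** A = mat 1"
  shows "matrix_inv A = B"
proof -
  have "A ** B = mat 1" using assms by (simp add: matrix_left_right_inverse)
  then have "A ** matrix_inv A = mat 1 \<and> matrix_inv A ** A = mat 1"
    unfolding matrix_inv_def using assms
    by (intro someI[of "\<lambda>A'. A ** A' = mat 1 \<and> A' ** A = mat 1" B] conjI)
  then show ?thesis using \<open>A ** B = mat 1\<close> assms
    by (metis matrix_mul_assoc matrix_mul_lid matrix_mul_rid)
qed

lemma scaled_factorization:
  fixes V :: "real^'n^'n"
  shows "(\<sigma> *\<^sub>R V) ** transpose (\<sigma> *\<^sub>R V) = \<sigma>\<^sup>2 *\<^sub>R (V ** transpose V)"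
  by (simp add: vec_eq_iff matrix_matrix_mult_def transpose_def power2_eq_square sum_distrib_left mult_ac)

lemma std_normal_coordinates:
  fixes P :: "('n::finite \<Rightarrow> real) measure"
  defines "P \<equiv> Pi\<^sub>M UNIV (\<lambda>_. std_normal_distribution)"
  shows "prob_space P"
    and "(\<lambda>z. \<chi> j. z j) \<in> borel_measurable P"
    and "(\<integral>z. iexp (\<Sum>j\<in>UNIV. s j * z j) \<partial>P) = complex_of_real (exp (- (\<Sum>j\<in>UNIV. (s j)\<^sup>2) / 2))"
proof -
  interpret N: real_distribution std_normal_distribution by (rule real_dist_normal_dist)
  interpret PP: product_prob_space "\<lambda>_::'n. std_normal_distribution" UNIV ..
  show "prob_space P" unfolding P_def by (rule PP.prob_space_axioms)
  show "(\<lambda>z. \<chi> j. z j) \<in> borel_measurable P"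
  proof (subst borel_measurable_euclidean_space, intro ballI)
    fix b :: "real^'n" assume "b \<in> Basis"
    then obtain j where b: "b = axis j 1" by (auto simp: Basis_vec_def)
    have "(\<lambda>z. z j) \<in> measurable P std_normal_distribution"
      unfolding P_def by (rule measurable_component_singleton) simp
    then show "(\<lambda>z. (\<chi> j. z j) \<bullet> b) \<in> borel_measurable P"
      by (simp add: b inner_axis)
  qed
  have "iexp (\<Sum>j\<in>UNIV. s j * z j) = (\<Prod>j\<in>UNIV. iexp (s j * z j))" for z :: "'n \<Rightarrow> real"
    by (simp add: exp_sum[symmetric] sum_distrib_left)
  then have "(\<integral>z. iexp (\<Sum>j\<in>UNIV. s j * z j) \<partial>P) = (\<integral>z. (\<Prod>j\<in>UNIV. iexp (s j * z j)) \<partial>P)"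
    by simp
  also have "\<dots> = (\<Prod>j\<in>UNIV. \<integral>x. iexp (s j * x) \<partial>std_normal_distribution)"
    unfolding P_def
    by (rule PP.product_integral_prod) (auto intro!: N.integrable_iexp)
  also have "\<dots> = (\<Prod>j\<in>UNIV. complex_of_real (exp (- (s j)\<^sup>2 / 2)))"
    using char_std_normal_distribution by (simp add: char_def fun_eq_iff)
  also have "\<dots> = complex_of_real (exp (- (\<Sum>j\<in>UNIV. (s j)\<^sup>2) / 2))"
    by (simp add: exp_sum[symmetric] sum_negf[symmetric] sum_divide_distrib of_real_prod[symmetric] del: of_real_prod)
  finally show "(\<integral>z. iexp (\<Sum>j\<in>UNIV. s j * z j) \<partial>P) = complex_of_real (exp (- (\<Sum>j\<in>UNIV. (s j)\<^sup>2) / 2))" .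
qed

text \<open>
  The characteristic function depends on the root \<open>B\<close> chosen in \<open>multi_normal\<close> only through the squared
  norm of \<open>B\<^sup>T t\<close>, which is the quadratic form of \<open>S\<close> at \<open>t\<close>. That the choice has
  this property is due to the existence of the root \<open>A\<close>.
\<close>
lemma multi_normal_char:
  fixes S A :: "real^'n^'n"
  assumes S: "A ** transpose A = S"
  shows "prob_space (multi_normal \<mu> S)" "sets (multi_normal \<mu> S) = sets borel"
    and "(\<integral>z. iexp (t \<bullet> z) \<partial>multi_normal 0 S) = complex_of_real (exp (- (t \<bullet> (S *v t)) / 2))"
proof -
  define P :: "('n \<Rightarrow> real) measure" where "P = Pi\<^sub>M UNIV (\<lambda>_. std_normal_distribution)"
  note P = std_normal_coordinates[where 'n = 'n, folded P_def]
  define B :: "real^'n^'n" where "B = (SOME A. A ** transpose A = S)"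
  have B: "B ** transpose B = S" unfolding B_def by (rule someI[of "\<lambda>A. A ** transpose A = S", OF S])
  have mn: "multi_normal \<mu> S = distr P borel (\<lambda>z. \<mu> + B *v (\<chi> j. z j))" for \<mu>
    unfolding multi_normal_def P_def B_def ..
  have mB[measurable]: "(\<lambda>z. \<mu> + B *v (\<chi> j. z j)) \<in> borel_measurable P" for \<mu>
    by (rule borel_measurable_continuous_on[OF _ P(2)]) (intro continuous_intros)
  show "prob_space (multi_normal \<mu> S)" unfolding mn by (rule prob_space.prob_space_distr[OF P(1)]) simp
  show "sets (multi_normal \<mu> S) = sets borel" by (simp add: mn)
  let ?s = "transpose B *v t"
  have "(\<integral>z. iexp (t \<bullet> z) \<partial>multi_normal 0 S) = (\<integral>z. iexp (\<Sum>j\<in>UNIV. ?s $ j * z j) \<partial>P)"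
  proof -
    have "t \<bullet> (0 + B *v (\<chi> j. z j)) = (\<Sum>j\<in>UNIV. ?s $ j * z j)" for z
      by (simp add: inner_matrix_vector_mult del: transpose_matrix_vector) (simp add: inner_vec_def)
    moreover have "(\<integral>z. iexp (t \<bullet> z) \<partial>multi_normal 0 S) = (\<integral>z. iexp (t \<bullet> (0 + B *v (\<chi> j. z j))) \<partial>P)"
      unfolding mn by (rule integral_distr[OF mB]) measurable
    ultimately show ?thesis by (simp only:)
  qed
  also have "\<dots> = complex_of_real (exp (- (?s \<bullet> ?s) / 2))"
    unfolding P(3) by (simp add: inner_vec_def power2_eq_square)
  also have "?s \<bullet> ?s = t \<bullet> (S *v t)"
    by (simp add: inner_matrix_vector_mult B[symmetric] matrix_vector_mul_assoc[symmetric])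
  finally show "(\<integral>z. iexp (t \<bullet> z) \<partial>multi_normal 0 S) = complex_of_real (exp (- (t \<bullet> (S *v t)) / 2))" .
qed

section \<open>The one-step criterion in the local parameter\<close>

text \<open>
  The local parameter. In it the least squares criterion becomes a quadratic function whose
  coefficients, the scaled Gram matrix and the score, are bounded in probability.
\<close>
definition scaled_error :: "nat \<Rightarrow> real^'p \<Rightarrow> real^'p \<Rightarrow> real^'p" where
  "scaled_error n \<beta>\<^sub>0 \<beta> = sqrt (real n) *\<^sub>R (\<beta> - \<beta>\<^sub>0)"

lemma rss_expansion:
  assumes "n > 0" and y: "\<And>i. i < n \<Longrightarrow> y i = x i \<bullet> \<beta>\<^sub>0 + \<epsilon> i"
  shows "rss n x y \<beta> = rss n x y \<beta>\<^sub>0 - 2 * (score n x \<epsilon> \<bullet> scaled_error n \<beta>\<^sub>0 \<beta>)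
      + scaled_error n \<beta>\<^sub>0 \<beta> \<bullet> (((1 / real n) *\<^sub>R gram n x) *v scaled_error n \<beta>\<^sub>0 \<beta>)"
proof -
  define d where "d = \<beta> - \<beta>\<^sub>0"
  have "rss n x y \<beta> = (\<Sum>i<n. (\<epsilon> i - d \<bullet> x i)\<^sup>2)"
    unfolding rss_def by (intro sum.cong refl) (simp add: y d_def inner_diff_right inner_commute algebra_simps)
  also have "\<dots> = (\<Sum>i<n. (\<epsilon> i)\<^sup>2) - 2 * (\<Sum>i<n. \<epsilon> i * (d \<bullet> x i)) + (\<Sum>i<n. (d \<bullet> x i)\<^sup>2)"
    by (simp add: power2_diff sum.distrib sum_subtractf sum_distrib_left mult_ac)
  also have "(\<Sum>i<n. (\<epsilon> i)\<^sup>2) = rss n x y \<beta>\<^sub>0"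
    unfolding rss_def by (intro sum.cong refl) (simp add: y)
  also have "(\<Sum>i<n. \<epsilon> i * (d \<bullet> x i)) = score n x \<epsilon> \<bullet> (sqrt (real n) *\<^sub>R d)"
    using \<open>n > 0\<close> by (simp add: score_def inner_sum_right inner_commute sum_distrib_left[symmetric])
  also have "(\<Sum>i<n. (d \<bullet> x i)\<^sup>2) = (sqrt (real n) *\<^sub>R d) \<bullet> (((1 / real n) *\<^sub>R gram n x) *v (sqrt (real n) *\<^sub>R d))"
    using \<open>n > 0\<close> by (simp add: inner_gram[symmetric] scaleR_matrix_vector_assoc[symmetric] matrix_vector_mult_scaleR mult.assoc[symmetric])
  finally show ?thesis unfolding d_def scaled_error_def .
qed

lemma transpose_gram: "transpose (gram n x) = gram n x"
  by (simp add: gram_def transpose_def vec_eq_iff mult.commute)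

text \<open>
  A weighted lasso criterion in the local parameter. With \<open>G\<close> the scaled Gram matrix, \<open>W\<close> the score,
  \<open>\<theta>\<close> the true parameter and \<open>\<kappa>\<close> the penalty derivatives, both multiplied by \<open>sqrt n\<close>, it
  is the one-step criterion up to an additive constant, and the sample size no longer appears.
\<close>
definition lasso_obj :: "real^'p^'p \<Rightarrow> real^'p \<Rightarrow> ('p \<Rightarrow> real) \<Rightarrow> real^'p \<Rightarrow> real^'p \<Rightarrow> real" where
  "lasso_obj G W \<kappa> \<theta> u = u \<bullet> (G *v u) / 2 - W \<bullet> u + (\<Sum>j\<in>UNIV. \<kappa> j * \<bar>\<theta> $ j + u $ j\<bar>)"

text \<open>
  Only coordinates with \<open>\<theta> $ j \<noteq> 0\<close> can lower the penalty below its value at \<open>0\<close>, and their weights are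
  at most \<open>\<delta>\<close>. The linear gain \<open>(norm W + CARD('p) * \<delta>) * norm u\<close> must pay for the quadratic cost
  \<open>c * (norm u)\<^sup>2 / 2\<close>.
\<close>
lemma lasso_obj_minimizer_bound:
  fixes u :: "real^'p"
  assumes coercive: "c > 0" "c * (norm u)\<^sup>2 \<le> u \<bullet> (G *v u)"
    and min: "lasso_obj G W \<kappa> \<theta> u \<le> lasso_obj G W \<kappa> \<theta> 0"
    and \<kappa>: "\<And>j. \<kappa> j \<ge> 0" "\<And>j. \<theta> $ j \<noteq> 0 \<Longrightarrow> \<kappa> j \<le> \<delta>" and "\<delta> \<ge> 0"
  shows "norm u \<le> 2 * (norm W + real CARD('p) * \<delta>) / c"
proof -
  have "\<kappa> j * \<bar>\<theta> $ j\<bar> - \<kappa> j * \<bar>\<theta> $ j + u $ j\<bar> \<le> \<delta> * norm u" for j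
  proof (cases "\<theta> $ j = 0")
    case True
    then have "\<kappa> j * \<bar>\<theta> $ j\<bar> - \<kappa> j * \<bar>\<theta> $ j + u $ j\<bar> \<le> 0" using \<kappa>(1)[of j] by simp
    also have "0 \<le> \<delta> * norm u" using \<open>\<delta> \<ge> 0\<close> by simp
    finally show ?thesis .
  next
    case False
    have "\<kappa> j * \<bar>\<theta> $ j\<bar> - \<kappa> j * \<bar>\<theta> $ j + u $ j\<bar> = \<kappa> j * (\<bar>\<theta> $ j\<bar> - \<bar>\<theta> $ j + u $ j\<bar>)"
      by (simp add: algebra_simps)
    also have "\<dots> \<le> \<kappa> j * norm u"
      using \<kappa>(1)[of j] component_le_norm_cart[of u j] by (intro mult_left_mono) auto
    also have "\<dots> \<le> \<delta> * norm u" using \<kappa>(2)[OF False] by (intro mult_right_mono) auto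
    finally show ?thesis .
  qed
  then have "(\<Sum>j\<in>UNIV. \<kappa> j * \<bar>\<theta> $ j\<bar>) - (\<Sum>j\<in>UNIV. \<kappa> j * \<bar>\<theta> $ j + u $ j\<bar>) \<le> (\<Sum>j\<in>(UNIV::'p set). \<delta> * norm u)"
    unfolding sum_subtractf[symmetric] by (intro sum_mono)
  then have "c * (norm u)\<^sup>2 / 2 \<le> W \<bullet> u + real CARD('p) * (\<delta> * norm u)"
    using min coercive(2) by (simp add: lasso_obj_def)
  also have "\<dots> \<le> (norm W + real CARD('p) * \<delta>) * norm u"
    using norm_cauchy_schwarz[of W u] by (simp add: algebra_simps)
  finally have "(c * norm u) * norm u \<le> (2 * (norm W + real CARD('p) * \<delta>)) * norm u"
    by (simp add: power2_eq_square algebra_simps)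
  then have "c * norm u \<le> 2 * (norm W + real CARD('p) * \<delta>) \<or> norm u = 0"
    using mult_right_le_imp_le[of "c * norm u" "norm u"] by (cases "norm u = 0") auto
  moreover have "0 \<le> 2 * (norm W + real CARD('p) * \<delta>)" using \<open>\<delta> \<ge> 0\<close> by simp
  ultimately show ?thesis using coercive(1) by (auto simp: pos_le_divide_eq mult.commute)
qed

lemma lasso_obj_coordinate_change:
  fixes G :: "real^'n^'n"
  assumes "transpose G = G"
  shows "lasso_obj G W \<kappa> \<theta> (u + axis j h) - lasso_obj G W \<kappa> \<theta> u
    = h * ((G *v u) $ j - W $ j) + h\<^sup>2 * G $ j $ j / 2 + \<kappa> j * (\<bar>\<theta> $ j + u $ j + h\<bar> - \<bar>\<theta> $ j + u $ j\<bar>)"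
proof -
  have G: "(G *v axis j h) $ j = h * G $ j $ j"
    by (simp add: matrix_vector_mult_def axis_def if_distrib cong: if_cong)
  have sym: "u \<bullet> (G *v axis j h) = axis j h \<bullet> (G *v u)"
    using inner_matrix_vector_mult[of u G "axis j h"] assms by (simp add: inner_commute)
  have quad: "(u + axis j h) \<bullet> (G *v (u + axis j h)) = u \<bullet> (G *v u) + 2 * h * (G *v u) $ j + h\<^sup>2 * G $ j $ j"
    by (simp add: matrix_vector_right_distrib inner_add_left inner_add_right sym inner_axis' G power2_eq_square)
  define P where "P v = (\<Sum>i\<in>UNIV. \<kappa> i * \<bar>\<theta> $ i + v $ i\<bar>)" for v :: "real^'n"
  have "P (u + axis j h) - P u = (\<Sum>i\<in>UNIV. if i = j then \<kappa> j * (\<bar>\<theta> $ j + u $ j + h\<bar> - \<bar>\<theta> $ j + u $ j\<bar>) else 0)"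
    unfolding P_def sum_subtractf[symmetric]
    by (intro sum.cong refl) (auto simp: axis_def algebra_simps)
  then have "P (u + axis j h) = P u + \<kappa> j * (\<bar>\<theta> $ j + u $ j + h\<bar> - \<bar>\<theta> $ j + u $ j\<bar>)" by simp
  moreover have "W \<bullet> (u + axis j h) = W \<bullet> u + h * W $ j" by (simp add: inner_add_right inner_axis)
  ultimately show ?thesis
    unfolding lasso_obj_def quad P_def[symmetric] by (simp add: algebra_simps add_divide_distrib)
qed

text \<open>
  Moving one coordinate by \<open>h\<close> changes the penalty by at most \<open>\<kappa> j * \<bar>h\<bar>\<close> and the quadratic part by
  \<open>h\<close> times the gradient up to order \<open>h\<^sup>2\<close>; a short step against the gradient would pay off
  if the gradient exceeded \<open>\<kappa> j\<close>.
\<close>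
lemma lasso_obj_stationarity:
  assumes "transpose G = G" "\<kappa> j \<ge> 0"
    and min: "\<And>h. lasso_obj G W \<kappa> \<theta> u \<le> lasso_obj G W \<kappa> \<theta> (u + axis j h)"
  shows "\<bar>(G *v u) $ j - W $ j\<bar> \<le> \<kappa> j"
proof (rule field_le_epsilon)
  fix e :: real assume "e > 0"
  define g where "g = (G *v u) $ j - W $ j"
  define t where "t = e / (\<bar>G $ j $ j\<bar> + 1)"
  define h where "h = - sgn g * t"
  have t: "t > 0" using \<open>e > 0\<close> by (simp add: t_def add_nonneg_pos)
  have "\<bar>h\<bar> \<le> t" using t by (simp add: h_def abs_mult abs_sgn_eq)
  have "0 \<le> h * g + h\<^sup>2 * G $ j $ j / 2 + \<kappa> j * (\<bar>\<theta> $ j + u $ j + h\<bar> - \<bar>\<theta> $ j + u $ j\<bar>)"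
    using min[of h] lasso_obj_coordinate_change[OF assms(1), of W \<kappa> \<theta> u j h] by (simp add: g_def)
  also have "\<kappa> j * (\<bar>\<theta> $ j + u $ j + h\<bar> - \<bar>\<theta> $ j + u $ j\<bar>) \<le> \<kappa> j * t"
    using assms(2) \<open>\<bar>h\<bar> \<le> t\<close> by (intro mult_left_mono) auto
  also have "h\<^sup>2 * G $ j $ j \<le> t\<^sup>2 * \<bar>G $ j $ j\<bar>"
  proof -
    have "h\<^sup>2 * G $ j $ j \<le> h\<^sup>2 * \<bar>G $ j $ j\<bar>" by (intro mult_left_mono) auto
    also have "\<dots> \<le> t\<^sup>2 * \<bar>G $ j $ j\<bar>"
      using power_mono[OF \<open>\<bar>h\<bar> \<le> t\<close>, of 2] by (intro mult_right_mono) auto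
    finally show ?thesis .
  qed
  also have "h * g = - t * \<bar>g\<bar>" by (simp add: h_def sgn_real_def)
  finally have "t * \<bar>g\<bar> \<le> t * (\<kappa> j + t * \<bar>G $ j $ j\<bar> / 2)"
    by (simp add: power2_eq_square algebra_simps)
  then have "\<bar>g\<bar> \<le> \<kappa> j + t * \<bar>G $ j $ j\<bar> / 2" using t by simp
  also have "t * \<bar>G $ j $ j\<bar> / 2 \<le> e" using \<open>e > 0\<close> by (simp add: t_def field_simps)
  finally show "\<bar>(G *v u) $ j - W $ j\<bar> \<le> \<kappa> j + e" by (simp add: g_def)
qed

text \<open>
  This is the source of sparsity: setting a coordinate to \<open>0\<close> saves the penalty \<open>\<kappa> j * \<bar>u $ j\<bar>\<close> and changes
  the quadratic part by at most \<open>\<bar>u $ j\<bar>\<close> times a bounded quantity, so for a minimizer a nonzero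
  coordinate is compatible with bounded weights only.
\<close>
lemma lasso_obj_nonzero_coordinate:
  assumes "transpose G = G" "\<theta> $ j = 0" "u $ j \<noteq> 0"
    and min: "lasso_obj G W \<kappa> \<theta> u \<le> lasso_obj G W \<kappa> \<theta> (u + axis j (- (u $ j)))"
  shows "\<kappa> j \<le> \<bar>W $ j\<bar> + \<bar>(G *v u) $ j\<bar> + \<bar>u $ j\<bar> * \<bar>G $ j $ j\<bar>"
proof -
  let ?h = "u $ j"
  have "\<kappa> j * \<bar>?h\<bar> \<le> - ?h * ((G *v u) $ j - W $ j) + ?h\<^sup>2 * G $ j $ j / 2"
    using min lasso_obj_coordinate_change[OF assms(1), of W \<kappa> \<theta> u j "- ?h"] assms(2) by simp
  also have "\<dots> \<le> \<bar>?h\<bar> * \<bar>(G *v u) $ j - W $ j\<bar> + \<bar>?h\<bar> * (\<bar>?h\<bar> * \<bar>G $ j $ j\<bar>)"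
  proof (rule add_mono)
    show "- ?h * ((G *v u) $ j - W $ j) \<le> \<bar>?h\<bar> * \<bar>(G *v u) $ j - W $ j\<bar>"
      by (metis abs_ge_self abs_minus_cancel abs_mult)
    have "?h\<^sup>2 * G $ j $ j \<le> ?h\<^sup>2 * \<bar>G $ j $ j\<bar>" by (intro mult_left_mono) auto
    moreover have "0 \<le> ?h\<^sup>2 * \<bar>G $ j $ j\<bar>" by simp
    moreover have "\<bar>?h\<bar> * (\<bar>?h\<bar> * \<bar>G $ j $ j\<bar>) = ?h\<^sup>2 * \<bar>G $ j $ j\<bar>"
      by (simp add: power2_eq_square mult.assoc[symmetric])
    ultimately show "?h\<^sup>2 * G $ j $ j / 2 \<le> \<bar>?h\<bar> * (\<bar>?h\<bar> * \<bar>G $ j $ j\<bar>)" by linarith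
  qed
  finally have "\<bar>?h\<bar> * \<kappa> j \<le> \<bar>?h\<bar> * (\<bar>(G *v u) $ j - W $ j\<bar> + \<bar>?h\<bar> * \<bar>G $ j $ j\<bar>)"
    by (simp add: algebra_simps)
  then have "\<kappa> j \<le> \<bar>(G *v u) $ j - W $ j\<bar> + \<bar>?h\<bar> * \<bar>G $ j $ j\<bar>" using assms(3) by simp
  then show ?thesis by linarith
qed

lemma ols_minimizer_lasso_obj:
  assumes "n > 0" and y: "\<And>i. i < n \<Longrightarrow> y i = x i \<bullet> \<beta>\<^sub>0 + \<epsilon> i"
    and min: "is_arg_min (rss n x y) (\<lambda>_. True) \<beta>"
  shows "lasso_obj ((1 / real n) *\<^sub>R gram n x) (score n x \<epsilon>) (\<lambda>_. 0) \<theta> (scaled_error n \<beta>\<^sub>0 \<beta>)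
    \<le> lasso_obj ((1 / real n) *\<^sub>R gram n x) (score n x \<epsilon>) (\<lambda>_. 0) \<theta> 0"
proof -
  have "rss n x y \<beta> \<le> rss n x y \<beta>\<^sub>0"
    using min by (auto simp: is_arg_min_linorder)
  then show ?thesis
    using rss_expansion[OF assms(1) y, where \<beta> = \<beta>] by (simp add: lasso_obj_def)
qed

lemma one_step_objective_real:
  fixes b :: "real^'p"
  assumes w: "\<And>j. pen_deriv p \<bar>b0 $ j\<bar> \<ge> 0" and feasible: "\<And>j. pen_deriv p \<bar>b0 $ j\<bar> = \<infinity> \<Longrightarrow> b $ j = 0"
  shows "one_step_objective n x y p b0 b =
    ereal (1 / 2 * rss n x y b + real n * (\<Sum>j\<in>UNIV. real_of_ereal (pen_deriv p \<bar>b0 $ j\<bar>) * \<bar>b $ j\<bar>))"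
proof -
  have "pen_deriv p \<bar>b0 $ j\<bar> * ereal \<bar>b $ j\<bar> = ereal (real_of_ereal (pen_deriv p \<bar>b0 $ j\<bar>) * \<bar>b $ j\<bar>)" for j
    using w[of j] feasible[of j] by (cases "pen_deriv p \<bar>b0 $ j\<bar>") auto
  then show ?thesis by (simp add: one_step_objective_def sum_ereal)
qed

text \<open>
  Infinite weights are constraints: the true parameter has finite criterion, hence a minimizer
  vanishes at every coordinate of infinite weight, and among the parameters that do so the
  criterion is finite and \<open>real_of_ereal\<close>, which sends \<open>\<infinity>\<close> to \<open>0\<close>, gives the correct weights.
\<close>
lemma one_step_minimizer_lasso_obj:
  fixes b b0 :: "real^'p"
  assumes "n > 0" and y: "\<And>i. i < n \<Longrightarrow> y i = x i \<bullet> \<beta>\<^sub>0 + \<epsilon> i"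
    and min: "is_arg_min (one_step_objective n x y p b0) (\<lambda>_. True) b"
    and w: "\<And>j. pen_deriv p \<bar>b0 $ j\<bar> \<ge> 0"
    and active: "\<And>j. \<beta>\<^sub>0 $ j \<noteq> 0 \<Longrightarrow> pen_deriv p \<bar>b0 $ j\<bar> \<noteq> \<infinity>"
  defines "\<kappa> \<equiv> \<lambda>j. sqrt (real n) * real_of_ereal (pen_deriv p \<bar>b0 $ j\<bar>)"
  shows "\<And>j. pen_deriv p \<bar>b0 $ j\<bar> = \<infinity> \<Longrightarrow> b $ j = 0"
    and "\<And>u. (\<And>j. pen_deriv p \<bar>b0 $ j\<bar> = \<infinity> \<Longrightarrow> u $ j = 0) \<Longrightarrow>
      lasso_obj ((1 / real n) *\<^sub>R gram n x) (score n x \<epsilon>) \<kappa> (sqrt (real n) *\<^sub>R \<beta>\<^sub>0) (scaled_error n \<beta>\<^sub>0 b)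
      \<le> lasso_obj ((1 / real n) *\<^sub>R gram n x) (score n x \<epsilon>) \<kappa> (sqrt (real n) *\<^sub>R \<beta>\<^sub>0) u"
proof -
  have le: "one_step_objective n x y p b0 b \<le> one_step_objective n x y p b0 \<beta>" for \<beta>
    using min by (auto simp: is_arg_min_linorder)
  show feas: "b $ j = 0" if "pen_deriv p \<bar>b0 $ j\<bar> = \<infinity>" for j
  proof (rule ccontr)
    assume "b $ j \<noteq> 0"
    have "pen_deriv p \<bar>b0 $ j\<bar> * ereal \<bar>b $ j\<bar> \<le> (\<Sum>j\<in>UNIV. pen_deriv p \<bar>b0 $ j\<bar> * ereal \<bar>b $ j\<bar>)"
      using w sum_mono2[of UNIV "{j}" "\<lambda>j. pen_deriv p \<bar>b0 $ j\<bar> * ereal \<bar>b $ j\<bar>"] by simp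
    then have "(\<Sum>j\<in>UNIV. pen_deriv p \<bar>b0 $ j\<bar> * ereal \<bar>b $ j\<bar>) = \<infinity>"
      using that \<open>b $ j \<noteq> 0\<close> by simp
    then have "one_step_objective n x y p b0 b = \<infinity>"
      using \<open>n > 0\<close> by (simp add: one_step_objective_def)
    moreover have "one_step_objective n x y p b0 \<beta>\<^sub>0 \<noteq> \<infinity>"
      using one_step_objective_real[OF w, of \<beta>\<^sub>0 n x y] active by force
    ultimately show False using le[of \<beta>\<^sub>0] by simp
  qed
  have obj: "1 / 2 * rss n x y \<beta> + real n * (\<Sum>j\<in>UNIV. real_of_ereal (pen_deriv p \<bar>b0 $ j\<bar>) * \<bar>\<beta> $ j\<bar>)
      = rss n x y \<beta>\<^sub>0 / 2 + lasso_obj ((1 / real n) *\<^sub>R gram n x) (score n x \<epsilon>) \<kappa>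
          (sqrt (real n) *\<^sub>R \<beta>\<^sub>0) (scaled_error n \<beta>\<^sub>0 \<beta>)" for \<beta>
  proof -
    have "real n * (\<Sum>j\<in>UNIV. real_of_ereal (pen_deriv p \<bar>b0 $ j\<bar>) * \<bar>\<beta> $ j\<bar>)
        = (\<Sum>j\<in>UNIV. \<kappa> j * \<bar>(sqrt (real n) *\<^sub>R \<beta>\<^sub>0) $ j + scaled_error n \<beta>\<^sub>0 \<beta> $ j\<bar>)"
      unfolding sum_distrib_left
    proof (intro sum.cong refl)
      fix j
      have "(sqrt (real n) *\<^sub>R \<beta>\<^sub>0) $ j + scaled_error n \<beta>\<^sub>0 \<beta> $ j = sqrt (real n) * \<beta> $ j"
        by (simp add: scaled_error_def algebra_simps)
      then show "real n * (real_of_ereal (pen_deriv p \<bar>b0 $ j\<bar>) * \<bar>\<beta> $ j\<bar>) =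
          \<kappa> j * \<bar>(sqrt (real n) *\<^sub>R \<beta>\<^sub>0) $ j + scaled_error n \<beta>\<^sub>0 \<beta> $ j\<bar>"
        by (simp add: \<kappa>_def abs_mult)
    qed
    then show ?thesis
      using rss_expansion[OF assms(1) y, where \<beta> = \<beta>] by (simp add: lasso_obj_def)
  qed
  fix u :: "real^'p"
  assume u: "\<And>j. pen_deriv p \<bar>b0 $ j\<bar> = \<infinity> \<Longrightarrow> u $ j = 0"
  define \<beta> where "\<beta> = \<beta>\<^sub>0 + (1 / sqrt (real n)) *\<^sub>R u"
  have u_eq: "scaled_error n \<beta>\<^sub>0 \<beta> = u" using \<open>n > 0\<close> by (simp add: scaled_error_def \<beta>_def)
  have feas': "\<beta> $ j = 0" if "pen_deriv p \<bar>b0 $ j\<bar> = \<infinity>" for j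
    using u[OF that] active[of j] that by (auto simp: \<beta>_def)
  show "lasso_obj ((1 / real n) *\<^sub>R gram n x) (score n x \<epsilon>) \<kappa> (sqrt (real n) *\<^sub>R \<beta>\<^sub>0) (scaled_error n \<beta>\<^sub>0 b)
      \<le> lasso_obj ((1 / real n) *\<^sub>R gram n x) (score n x \<epsilon>) \<kappa> (sqrt (real n) *\<^sub>R \<beta>\<^sub>0) u"
  proof -
    have "one_step_objective n x y p b0 b = ereal (rss n x y \<beta>\<^sub>0 / 2 + lasso_obj ((1 / real n) *\<^sub>R gram n x)
        (score n x \<epsilon>) \<kappa> (sqrt (real n) *\<^sub>R \<beta>\<^sub>0) (scaled_error n \<beta>\<^sub>0 b))"
      unfolding obj[symmetric] by (rule one_step_objective_real) (fact w, fact feas)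
    moreover have "one_step_objective n x y p b0 \<beta> = ereal (rss n x y \<beta>\<^sub>0 / 2 + lasso_obj ((1 / real n) *\<^sub>R gram n x)
        (score n x \<epsilon>) \<kappa> (sqrt (real n) *\<^sub>R \<beta>\<^sub>0) u)"
      unfolding u_eq[symmetric] obj[symmetric] by (rule one_step_objective_real) (fact w, fact feas')
    ultimately show ?thesis using le[of \<beta>] by simp
  qed
qed

lemma pos_definite_coercive:
  fixes C :: "real^'n^'n"
  assumes "pos_definite C"
  obtains c where "c > 0" "\<And>v. c * (norm v)\<^sup>2 \<le> v \<bullet> (C *v v)"
proof -
  have "continuous_on (sphere 0 1) (\<lambda>v. v \<bullet> (C *v v))"
    by (intro continuous_intros)
  moreover have "sphere (0 :: real^'n) 1 \<noteq> {}" by simp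
  ultimately obtain v0 where v0: "v0 \<in> sphere 0 1" "\<And>v. v \<in> sphere 0 1 \<Longrightarrow> v0 \<bullet> (C *v v0) \<le> v \<bullet> (C *v v)"
    using continuous_attains_inf[OF compact_sphere] by blast
  show thesis
  proof
    show "v0 \<bullet> (C *v v0) > 0" using assms v0(1) by (metis norm_zero pos_definite_def dist_0_norm mem_sphere zero_neq_one)
    fix v :: "real^'n"
    show "v0 \<bullet> (C *v v0) * (norm v)\<^sup>2 \<le> v \<bullet> (C *v v)"
    proof (cases "v = 0")
      case False
      define e where "e = (1 / norm v) *\<^sub>R v"
      have "v0 \<bullet> (C *v v0) * (norm v)\<^sup>2 \<le> e \<bullet> (C *v e) * (norm v)\<^sup>2"
        using False by (intro mult_right_mono v0(2)) (auto simp: e_def)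
      also have "\<dots> = v \<bullet> (C *v v)"
        using False by (simp add: e_def matrix_vector_mult_scaleR power2_eq_square)
      finally show ?thesis .
    qed simp
  qed
qed

lemma matrix_vector_mult_entrywise_bound:
  fixes A :: "real^'n^'m"
  assumes "\<And>j k. \<bar>A $ j $ k\<bar> \<le> \<eta>"
  shows "\<bar>(A *v v) $ j\<bar> \<le> real CARD('n) * \<eta> * norm v"
proof -
  have "\<bar>(A *v v) $ j\<bar> \<le> (\<Sum>k\<in>UNIV. \<bar>A $ j $ k\<bar> * \<bar>v $ k\<bar>)"
    unfolding matrix_vector_mult_def by (simp add: sum_abs[THEN order_trans] abs_mult)
  also have "\<dots> \<le> (\<Sum>k\<in>(UNIV::'n set). \<eta> * norm v)"
    using assms component_le_norm_cart[of v]
    by (intro sum_mono mult_mono) (auto intro: order_trans[OF abs_ge_zero])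
  finally show ?thesis by simp
qed

lemma coercive_perturbation:
  fixes C G :: "real^'n^'n"
  assumes "c * (norm v)\<^sup>2 \<le> v \<bullet> (C *v v)" and "\<And>j k. \<bar>G $ j $ k - C $ j $ k\<bar> \<le> \<eta>"
  shows "(c - (real CARD('n))\<^sup>2 * \<eta>) * (norm v)\<^sup>2 \<le> v \<bullet> (G *v v)"
proof -
  have "\<bar>v \<bullet> ((G - C) *v v)\<bar> \<le> (\<Sum>j\<in>UNIV. \<bar>v $ j\<bar> * \<bar>((G - C) *v v) $ j\<bar>)"
    unfolding inner_vec_def by (simp add: sum_abs[THEN order_trans] abs_mult)
  also have "\<dots> \<le> (\<Sum>j\<in>(UNIV::'n set). norm v * (real CARD('n) * \<eta> * norm v))"
    using assms(2) component_le_norm_cart[of v]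
    by (intro sum_mono mult_mono matrix_vector_mult_entrywise_bound) auto
  finally have "\<bar>v \<bullet> ((G - C) *v v)\<bar> \<le> (real CARD('n))\<^sup>2 * \<eta> * (norm v)\<^sup>2"
    by (simp add: power2_eq_square algebra_simps)
  moreover have "v \<bullet> (G *v v) = v \<bullet> (C *v v) + v \<bullet> ((G - C) *v v)"
    by (simp add: matrix_vector_mult_diff_rdistrib inner_diff_right)
  ultimately have "c * (norm v)\<^sup>2 - (real CARD('n))\<^sup>2 * \<eta> * (norm v)\<^sup>2 \<le> v \<bullet> (G *v v)"
    using assms(1) by linarith
  then show ?thesis by (simp only: left_diff_distrib)
qed

section \<open>Selection of the nonzero coefficients\<close>

text \<open>
  What the proof needs of a sequence of penalties. At distance \<open>O(1 / sqrt n)\<close> from \<open>0\<close> the derivative,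
  scaled by \<open>sqrt n\<close>, tends to infinity; at distance \<open>O(1 / sqrt n)\<close> from a positive number it tends to \<open>0\<close>.
  These are the places where a \<open>sqrt n\<close>-consistent initial estimator puts the absolute values of zero and
  nonzero coefficients.
\<close>
definition separating_penalties :: "(nat \<Rightarrow> real \<Rightarrow> real) \<Rightarrow> bool" where
  "separating_penalties P \<longleftrightarrow>
     (\<forall>n \<theta>. \<theta> \<ge> 0 \<longrightarrow> pen_deriv (P n) \<theta> \<ge> 0) \<and>
     (\<forall>R L. \<forall>\<^sub>F n in sequentially. \<forall>\<theta>. 0 \<le> \<theta> \<and> sqrt (real n) * \<theta> \<le> R \<longrightarrow>
        ereal L < ereal (sqrt (real n)) * pen_deriv (P n) \<theta>) \<and>
     (\<forall>\<theta>\<^sub>0 R \<delta>. \<theta>\<^sub>0 > 0 \<and> \<delta> > 0 \<longrightarrow>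
        (\<forall>\<^sub>F n in sequentially. \<forall>\<theta>\<ge>0. sqrt (real n) * \<bar>\<theta> - \<theta>\<^sub>0\<bar> \<le> R \<longrightarrow>
          ereal (sqrt (real n)) * pen_deriv (P n) \<theta> \<le> ereal \<delta>))"

text \<open>
  The deterministic core, for one sample. Where the scaled Gram matrix is close to \<open>C\<close> and the
  score is bounded by \<open>K\<close>, least squares has local parameter at most \<open>2 * K / c\<close>, so the weights are large
  at zero coefficients and at most \<open>\<delta>\<close> at the others. The latter bounds the local parameter of the one-step
  estimator by \<open>R\<close>, and then the former exceeds what a nonzero coordinate tolerates. At the remaining
  coordinates stationarity is an approximate normal equation.
\<close>
lemma one_step_minimizer_selection:
  fixes C :: "real^'p^'p" and b0 b :: "real^'p"
  assumes "n > 0" and y: "\<forall>i. y i = x i \<bullet> \<beta>\<^sub>0 + \<epsilon> i"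
    and ols: "is_arg_min (rss n x y) (\<lambda>_. True) b0"
    and min: "is_arg_min (one_step_objective n x y p b0) (\<lambda>_. True) b"
    and coercive: "c > 0" "\<And>v. 2 * c * (norm v)\<^sup>2 \<le> v \<bullet> (C *v v)"
    and gram_close: "\<And>j k. \<bar>((1 / real n) *\<^sub>R gram n x) $ j $ k - C $ j $ k\<bar> \<le> \<eta>"
    and \<eta>: "(real CARD('p))\<^sup>2 * \<eta> \<le> c" "\<eta> \<le> 1"
    and score: "norm (score n x \<epsilon>) \<le> K"
    and nonneg: "\<forall>\<theta>\<ge>0. pen_deriv p \<theta> \<ge> 0"
    and active: "\<forall>j\<in>{j. \<beta>\<^sub>0 $ j \<noteq> 0}. \<forall>\<theta>\<ge>0. sqrt (real n) * \<bar>\<theta> - \<bar>\<beta>\<^sub>0 $ j\<bar>\<bar> \<le> 2 * K / c \<longrightarrow>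
      ereal (sqrt (real n)) * pen_deriv p \<theta> \<le> ereal \<delta>"
    and R: "R = 2 * (K + real CARD('p) * \<delta>) / c" and "\<delta> \<ge> 0"
    and inactive: "\<forall>\<theta>. 0 \<le> \<theta> \<and> sqrt (real n) * \<theta> \<le> 2 * K / c \<longrightarrow>
      ereal (K + real CARD('p) * (norm C + 1) * R + R * (norm C + 1)) < ereal (sqrt (real n)) * pen_deriv p \<theta>"
  shows "\<beta>\<^sub>0 $ j = 0 \<Longrightarrow> b $ j = 0"
    and "\<beta>\<^sub>0 $ j \<noteq> 0 \<Longrightarrow> \<bar>(C *v scaled_error n \<beta>\<^sub>0 b) $ j - score n x \<epsilon> $ j\<bar> \<le> \<delta> + real CARD('p) * \<eta> * R"
proof -
  have y: "\<And>i. i < n \<Longrightarrow> y i = x i \<bullet> \<beta>\<^sub>0 + \<epsilon> i" using y by blast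
  define G where "G = (1 / real n) *\<^sub>R gram n x"
  define W where "W = score n x \<epsilon>"
  define u0 where "u0 = scaled_error n \<beta>\<^sub>0 b0"
  define u where "u = scaled_error n \<beta>\<^sub>0 b"
  define \<theta> where "\<theta> = sqrt (real n) *\<^sub>R \<beta>\<^sub>0"
  define \<kappa> where "\<kappa> j = sqrt (real n) * real_of_ereal (pen_deriv p \<bar>b0 $ j\<bar>)" for j
  have close: "\<bar>G $ j $ k - C $ j $ k\<bar> \<le> \<eta>" for j k using gram_close by (simp add: G_def)
  have "\<eta> \<ge> 0" using close[of undefined undefined] by linarith
  have sym: "transpose G = G" using transpose_gram[of n x] by (simp add: G_def transpose_def vec_eq_iff)
  have G: "c * (norm v)\<^sup>2 \<le> v \<bullet> (G *v v)" for v
  proof -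
    have "c * (norm v)\<^sup>2 \<le> (2 * c - (real CARD('p))\<^sup>2 * \<eta>) * (norm v)\<^sup>2"
      using \<eta>(1) by (intro mult_right_mono) auto
    also have "\<dots> \<le> v \<bullet> (G *v v)" by (rule coercive_perturbation[OF coercive(2) close])
    finally show ?thesis .
  qed
  have "norm u0 \<le> 2 * (norm W + real CARD('p) * 0) / c"
    using ols_minimizer_lasso_obj[OF \<open>n > 0\<close> y ols, where \<theta> = 0]
    by (intro lasso_obj_minimizer_bound[OF coercive(1) G, where \<kappa> = "\<lambda>_. 0" and \<theta> = 0])
       (auto simp: G_def W_def u0_def)
  also have "\<dots> \<le> 2 * K / c" using score coercive(1) by (simp add: W_def divide_right_mono)
  finally have u0: "norm u0 \<le> 2 * K / c" .
  have w_nonneg: "pen_deriv p \<bar>b0 $ j\<bar> \<ge> 0" for j using nonneg by simp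
  have w_active: "ereal (sqrt (real n)) * pen_deriv p \<bar>b0 $ j\<bar> \<le> ereal \<delta>" if "\<beta>\<^sub>0 $ j \<noteq> 0" for j
  proof (rule active[rule_format, OF CollectI, OF that])
    have "sqrt (real n) * \<bar>\<bar>b0 $ j\<bar> - \<bar>\<beta>\<^sub>0 $ j\<bar>\<bar> \<le> sqrt (real n) * \<bar>b0 $ j - \<beta>\<^sub>0 $ j\<bar>"
      by (intro mult_left_mono) auto
    also have "\<dots> = \<bar>u0 $ j\<bar>" by (simp add: u0_def scaled_error_def abs_mult)
    also have "\<dots> \<le> 2 * K / c" using component_le_norm_cart[of u0 j] u0 by linarith
    finally show "sqrt (real n) * \<bar>\<bar>b0 $ j\<bar> - \<bar>\<beta>\<^sub>0 $ j\<bar>\<bar> \<le> 2 * K / c" .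
  qed simp
  have w_inactive: "ereal (K + real CARD('p) * (norm C + 1) * R + R * (norm C + 1))
      < ereal (sqrt (real n)) * pen_deriv p \<bar>b0 $ j\<bar>" if "\<beta>\<^sub>0 $ j = 0" for j
  proof (rule inactive[rule_format], intro conjI)
    have "sqrt (real n) * \<bar>b0 $ j\<bar> = \<bar>u0 $ j\<bar>" using that by (simp add: u0_def scaled_error_def abs_mult)
    also have "\<dots> \<le> 2 * K / c" using component_le_norm_cart[of u0 j] u0 by linarith
    finally show "sqrt (real n) * \<bar>b0 $ j\<bar> \<le> 2 * K / c" .
  qed simp
  have finite_active: "pen_deriv p \<bar>b0 $ j\<bar> \<noteq> \<infinity>" if "\<beta>\<^sub>0 $ j \<noteq> 0" for j
    using w_active[OF that] \<open>n > 0\<close> by auto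
  have \<kappa>_ereal: "ereal (sqrt (real n)) * pen_deriv p \<bar>b0 $ j\<bar> = ereal (\<kappa> j)" if "pen_deriv p \<bar>b0 $ j\<bar> \<noteq> \<infinity>" for j
    using that w_nonneg[of j] by (cases "pen_deriv p \<bar>b0 $ j\<bar>") (auto simp: \<kappa>_def)
  have \<kappa>_nonneg: "\<kappa> j \<ge> 0" for j
    using w_nonneg[of j] by (simp add: \<kappa>_def real_of_ereal_pos)
  have \<kappa>_active: "\<kappa> j \<le> \<delta>" if "\<beta>\<^sub>0 $ j \<noteq> 0" for j
    using w_active[OF that] \<kappa>_ereal[OF finite_active[OF that]] by simp
  note one_step = one_step_minimizer_lasso_obj[OF \<open>n > 0\<close> y min w_nonneg finite_active,
      folded G_def W_def u_def \<theta>_def, folded \<kappa>_def]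
  have u_feasible: "u $ j = 0" if "pen_deriv p \<bar>b0 $ j\<bar> = \<infinity>" for j
    using one_step(1)[of j] finite_active[of j] that by (cases "\<beta>\<^sub>0 $ j = 0") (auto simp: u_def scaled_error_def)
  have min0: "lasso_obj G W \<kappa> \<theta> u \<le> lasso_obj G W \<kappa> \<theta> 0" by (rule one_step(2)) auto
  have min_coordinate: "lasso_obj G W \<kappa> \<theta> u \<le> lasso_obj G W \<kappa> \<theta> (u + axis j h)"
    if "pen_deriv p \<bar>b0 $ j\<bar> \<noteq> \<infinity>" for j h
    using u_feasible that by (intro one_step(2)) (auto simp: axis_def)
  have "norm u \<le> 2 * (norm W + real CARD('p) * \<delta>) / c"
    using \<kappa>_active \<open>n > 0\<close>
    by (intro lasso_obj_minimizer_bound[OF coercive(1) G min0 \<kappa>_nonneg _ \<open>\<delta> \<ge> 0\<close>]) (auto simp: \<theta>_def)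
  also have "\<dots> \<le> R"
    unfolding R using score coercive(1) by (simp add: W_def divide_right_mono)
  finally have u: "norm u \<le> R" .
  have G_entry: "\<bar>G $ j $ k\<bar> \<le> norm C + 1" for j k
  proof -
    have "\<bar>C $ j $ k\<bar> \<le> norm (C $ j)" by (rule component_le_norm_cart)
    also have "\<dots> \<le> norm C" by (rule Finite_Cartesian_Product.norm_nth_le)
    finally show ?thesis using close[of j k] \<eta>(2) by linarith
  qed
  show "b $ j = 0" if j: "\<beta>\<^sub>0 $ j = 0"
  proof (rule ccontr)
    assume "b $ j \<noteq> 0"
    then have "u $ j \<noteq> 0" using j \<open>n > 0\<close> by (simp add: u_def scaled_error_def)
    have finite: "pen_deriv p \<bar>b0 $ j\<bar> \<noteq> \<infinity>" using one_step(1)[of j] \<open>b $ j \<noteq> 0\<close> by blast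
    have "\<kappa> j \<le> \<bar>W $ j\<bar> + \<bar>(G *v u) $ j\<bar> + \<bar>u $ j\<bar> * \<bar>G $ j $ j\<bar>"
      using j by (intro lasso_obj_nonzero_coordinate[OF sym _ \<open>u $ j \<noteq> 0\<close> min_coordinate[OF finite]]) (simp add: \<theta>_def)
    also have "\<bar>W $ j\<bar> \<le> K" using component_le_norm_cart[of W j] score by (simp add: W_def)
    also have "\<bar>(G *v u) $ j\<bar> \<le> real CARD('p) * (norm C + 1) * norm u"
      by (rule matrix_vector_mult_entrywise_bound[OF G_entry])
    also have "\<dots> \<le> real CARD('p) * (norm C + 1) * R"
      using u by (intro mult_left_mono) auto
    also have "\<bar>u $ j\<bar> * \<bar>G $ j $ j\<bar> \<le> R * (norm C + 1)"
      using component_le_norm_cart[of u j] u G_entry[of j j] by (intro mult_mono) auto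
    finally show False using w_inactive[OF j] \<kappa>_ereal[OF finite] by simp
  qed
  show "\<bar>(C *v scaled_error n \<beta>\<^sub>0 b) $ j - score n x \<epsilon> $ j\<bar> \<le> \<delta> + real CARD('p) * \<eta> * R" if j: "\<beta>\<^sub>0 $ j \<noteq> 0"
  proof -
    have "\<bar>(G *v u) $ j - W $ j\<bar> \<le> \<kappa> j"
      by (rule lasso_obj_stationarity[OF sym \<kappa>_nonneg min_coordinate[OF finite_active[OF j]]])
    moreover have "\<bar>((G - C) *v u) $ j\<bar> \<le> real CARD('p) * \<eta> * norm u"
      by (rule matrix_vector_mult_entrywise_bound) (use close in simp)
    moreover have "real CARD('p) * \<eta> * norm u \<le> real CARD('p) * \<eta> * R"
      using u \<open>\<eta> \<ge> 0\<close> by (intro mult_left_mono) auto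
    moreover have "((G - C) *v u) $ j = (G *v u) $ j - (C *v u) $ j"
      by (simp add: matrix_vector_mult_diff_rdistrib)
    ultimately show ?thesis using \<kappa>_active[OF j] unfolding u_def[symmetric] W_def[symmetric] by linarith
  qed
qed

text \<open>
  The constants are fixed in this order: the coercivity constant of \<open>C\<close>, then \<open>\<delta>\<close> and \<open>R\<close>, and last
  the tolerance \<open>\<eta>\<close> for the Gram matrix, small enough for coercivity and for the total error \<open>\<tau>\<close>.
\<close>
lemma one_step_eventually_selection:
  fixes C :: "real^'p^'p" and \<beta>\<^sub>0 :: "real^'p"
  assumes "pos_definite C" and P: "separating_penalties P" and "K \<ge> 0" "\<tau> > 0"
  shows "\<exists>\<eta>>0. \<forall>\<^sub>F n in sequentially. \<forall>x \<epsilon> y b0 b.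
    (\<forall>i. y i = x i \<bullet> \<beta>\<^sub>0 + \<epsilon> i) \<longrightarrow>
    is_arg_min (rss n x y) (\<lambda>_. True) b0 \<longrightarrow>
    is_arg_min (one_step_objective n x y (P n) b0) (\<lambda>_. True) b \<longrightarrow>
    (\<forall>j k. \<bar>((1 / real n) *\<^sub>R gram n x) $ j $ k - C $ j $ k\<bar> \<le> \<eta>) \<longrightarrow>
    norm (score n x \<epsilon>) \<le> K \<longrightarrow>
    (\<forall>j. if \<beta>\<^sub>0 $ j = 0 then b $ j = 0
      else \<bar>(C *v scaled_error n \<beta>\<^sub>0 b) $ j - score n x \<epsilon> $ j\<bar> \<le> \<tau>)"
proof -
  obtain c0 where c0: "c0 > 0" "\<And>v. c0 * (norm v)\<^sup>2 \<le> v \<bullet> (C *v v)"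
    using pos_definite_coercive[OF assms(1)] by blast
  define c where "c = c0 / 2"
  have c: "c > 0" "\<And>v. 2 * c * (norm v)\<^sup>2 \<le> v \<bullet> (C *v v)" using c0 by (auto simp: c_def)
  let ?p = "real CARD('p)"
  define \<delta> where "\<delta> = \<tau> / 2"
  define R where "R = 2 * (K + ?p * \<delta>) / c"
  have R: "R \<ge> 0" using c(1) assms by (simp add: R_def \<delta>_def)
  define \<eta> where "\<eta> = min 1 (min (c / ?p\<^sup>2) (\<tau> / (2 * ?p * (R + 1))))"
  have \<eta>: "\<eta> > 0" "\<eta> \<le> 1" using c(1) \<open>\<tau> > 0\<close> R by (auto simp: \<eta>_def)
  have "\<eta> \<le> c / ?p\<^sup>2" by (simp add: \<eta>_def)
  then have \<eta>c: "?p\<^sup>2 * \<eta> \<le> c" by (simp add: field_simps)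
  have "\<eta> \<le> \<tau> / (2 * ?p * (R + 1))" by (simp add: \<eta>_def)
  then have "\<eta> * (2 * ?p * (R + 1)) \<le> \<tau>" using R by (subst (asm) pos_le_divide_eq) auto
  then have "?p * \<eta> * (R + 1) \<le> \<tau> / 2" by (simp add: algebra_simps)
  moreover have "?p * \<eta> * R \<le> ?p * \<eta> * (R + 1)" using \<eta>(1) by (intro mult_left_mono) auto
  ultimately have \<tau>: "\<delta> + ?p * \<eta> * R \<le> \<tau>" unfolding \<delta>_def by linarith
  have nonneg: "\<forall>\<theta>\<ge>0. pen_deriv (P n) \<theta> \<ge> 0" for n
    using P by (simp add: separating_penalties_def)
  have "\<forall>\<^sub>F n in sequentially. \<forall>\<theta>. 0 \<le> \<theta> \<and> sqrt (real n) * \<theta> \<le> 2 * K / c \<longrightarrow>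
      ereal (K + ?p * (norm C + 1) * R + R * (norm C + 1)) < ereal (sqrt (real n)) * pen_deriv (P n) \<theta>"
    using P unfolding separating_penalties_def by blast
  moreover have "\<forall>\<^sub>F n in sequentially. \<forall>j\<in>{j. \<beta>\<^sub>0 $ j \<noteq> 0}. \<forall>\<theta>\<ge>0. sqrt (real n) * \<bar>\<theta> - \<bar>\<beta>\<^sub>0 $ j\<bar>\<bar> \<le> 2 * K / c \<longrightarrow>
      ereal (sqrt (real n)) * pen_deriv (P n) \<theta> \<le> ereal \<delta>"
  proof (rule eventually_ball_finite, simp, rule ballI)
    fix j assume "j \<in> {j. \<beta>\<^sub>0 $ j \<noteq> 0}"
    then have "\<bar>\<beta>\<^sub>0 $ j\<bar> > 0" "\<delta> > 0" using \<open>\<tau> > 0\<close> by (auto simp: \<delta>_def)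
    then show "\<forall>\<^sub>F n in sequentially. \<forall>\<theta>\<ge>0. sqrt (real n) * \<bar>\<theta> - \<bar>\<beta>\<^sub>0 $ j\<bar>\<bar> \<le> 2 * K / c \<longrightarrow>
      ereal (sqrt (real n)) * pen_deriv (P n) \<theta> \<le> ereal \<delta>"
      using P unfolding separating_penalties_def by blast
  qed
  ultimately have "\<forall>\<^sub>F n in sequentially. \<forall>x \<epsilon> y b0 b.
    (\<forall>i. y i = x i \<bullet> \<beta>\<^sub>0 + \<epsilon> i) \<longrightarrow>
    is_arg_min (rss n x y) (\<lambda>_. True) b0 \<longrightarrow>
    is_arg_min (one_step_objective n x y (P n) b0) (\<lambda>_. True) b \<longrightarrow>
    (\<forall>j k. \<bar>((1 / real n) *\<^sub>R gram n x) $ j $ k - C $ j $ k\<bar> \<le> \<eta>) \<longrightarrow>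
    norm (score n x \<epsilon>) \<le> K \<longrightarrow>
    (\<forall>j. if \<beta>\<^sub>0 $ j = 0 then b $ j = 0
      else \<bar>(C *v scaled_error n \<beta>\<^sub>0 b) $ j - score n x \<epsilon> $ j\<bar> \<le> \<tau>)"
    using eventually_gt_at_top[of 0]
  proof eventually_elim
    case (elim n)
    show ?case
    proof (intro allI impI)
      fix x y and \<epsilon> :: "nat \<Rightarrow> real" and b0 b and j
      assume y: "\<forall>i. y i = x i \<bullet> \<beta>\<^sub>0 + \<epsilon> i"
        and mins: "is_arg_min (rss n x y) (\<lambda>_. True) b0" "is_arg_min (one_step_objective n x y (P n) b0) (\<lambda>_. True) b"
        and close: "\<forall>j k. \<bar>((1 / real n) *\<^sub>R gram n x) $ j $ k - C $ j $ k\<bar> \<le> \<eta>"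
        and score: "norm (score n x \<epsilon>) \<le> K"
      have "\<delta> \<ge> 0" using \<open>\<tau> > 0\<close> by (simp add: \<delta>_def)
      have close: "\<And>j k. \<bar>((1 / real n) *\<^sub>R gram n x) $ j $ k - C $ j $ k\<bar> \<le> \<eta>" using close by blast
      note selection = one_step_minimizer_selection[OF elim(3) y mins c close \<eta>c \<eta>(2) score nonneg elim(2) R_def
        \<open>\<delta> \<ge> 0\<close> elim(1), of j]
      show "if \<beta>\<^sub>0 $ j = 0 then b $ j = 0
        else \<bar>(C *v scaled_error n \<beta>\<^sub>0 b) $ j - score n x \<epsilon> $ j\<bar> \<le> \<tau>"
        using selection \<tau> by auto
    qed
  qed
  with \<eta>(1) show ?thesis by blast
qed

definition bad_event ::
  "'a measure \<Rightarrow> (nat \<Rightarrow> 'a \<Rightarrow> real^'p) \<Rightarrow> (nat \<Rightarrow> 'a \<Rightarrow> real) \<Rightarrow> real^'p^'p \<Rightarrow> real \<Rightarrow> real \<Rightarrow> nat \<Rightarrow> 'a set" where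
  "bad_event M x \<epsilon> C \<eta> K n = {\<omega>\<in>space M. norm (score n (\<lambda>i. x i \<omega>) (\<lambda>i. \<epsilon> i \<omega>)) > K} \<union>
    {\<omega>\<in>space M. \<exists>j k. \<bar>((1 / real n) *\<^sub>R gram n (\<lambda>i. x i \<omega>)) $ j $ k - C $ j $ k\<bar> > \<eta>}"

lemma linear_model_measurable:
  assumes "linear_model M x \<epsilon> y \<beta>\<^sub>0 \<sigma>"
  shows "\<epsilon> i \<in> borel_measurable M" "x i \<in> borel_measurable M"
    and "(\<lambda>\<omega>. score n (\<lambda>i. x i \<omega>) (\<lambda>i. \<epsilon> i \<omega>)) \<in> borel_measurable M"
    and "(\<lambda>\<omega>. ((1 / real n) *\<^sub>R gram n (\<lambda>i. x i \<omega>)) $ j $ k) \<in> borel_measurable M"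
proof -
  interpret prob_space M using assms by (simp add: linear_model_def)
  have "indep_vars (\<lambda>_. borel) \<epsilon> UNIV" using assms by (simp add: linear_model_def)
  then show [measurable]: "\<epsilon> i \<in> borel_measurable M" for i by (auto simp: indep_vars_def)
  show [measurable]: "x i \<in> borel_measurable M" for i using assms by (simp add: linear_model_def)
  show "(\<lambda>\<omega>. score n (\<lambda>i. x i \<omega>) (\<lambda>i. \<epsilon> i \<omega>)) \<in> borel_measurable M"
    unfolding score_def by measurable
  have [measurable]: "(\<lambda>\<omega>. x i \<omega> $ j) \<in> borel_measurable M" for i j
    by (rule borel_measurable_continuous_on[of "\<lambda>v. v $ j"]) (auto intro!: continuous_intros)
  show "(\<lambda>\<omega>. ((1 / real n) *\<^sub>R gram n (\<lambda>i. x i \<omega>)) $ j $ k) \<in> borel_measurable M"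
    by (simp add: gram_def)
qed

lemma bad_event_measurable:
  assumes "linear_model M x \<epsilon> y \<beta>\<^sub>0 \<sigma>"
  shows "bad_event M x \<epsilon> C \<eta> K n \<in> sets M"
  using linear_model_measurable[OF assms, measurable] unfolding bad_event_def by measurable

text \<open>
  The score is tight because its characteristic functions converge to that of a normal law.
  Chebyshev's inequality, applied unconditionally, would ask for second moments of the design.
\<close>
lemma bad_event_small:
  fixes x :: "nat \<Rightarrow> 'a \<Rightarrow> real^'p"
  assumes model: "linear_model M x \<epsilon> y \<beta>\<^sub>0 \<sigma>"
    and gram: "AE \<omega> in M. (\<lambda>n. (1 / real n) *\<^sub>R gram n (\<lambda>i. x i \<omega>)) \<longlonglongrightarrow> C"
    and C: "pos_definite C" and "\<delta> > 0"
  shows "\<exists>K>0. \<forall>\<eta>>0. \<forall>\<^sub>F n in sequentially. measure M (bad_event M x \<epsilon> C \<eta> K n) < \<delta>"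
proof -
  interpret prob_space M using model by (simp add: linear_model_def)
  note [measurable] = linear_model_measurable[OF model]
  obtain V :: "real^'p^'p" where V: "C ** (V ** transpose V) = mat 1"
    using pos_definite_inverse_factorization[OF C] by blast
  have "(C ** V) ** transpose (C ** V) = C"
  proof -
    have "transpose C = C" using C by (simp add: pos_definite_def)
    then have "(C ** V) ** transpose (C ** V) = (C ** (V ** transpose V)) ** C"
      by (simp add: matrix_transpose_mul matrix_mul_assoc)
    then show ?thesis by (simp add: V)
  qed
  then have root: "(\<sigma> *\<^sub>R (C ** V)) ** transpose (\<sigma> *\<^sub>R (C ** V)) = \<sigma>\<^sup>2 *\<^sub>R C"
    by (simp add: scaled_factorization)
  have char: "(\<lambda>n. \<integral>\<omega>. iexp (t \<bullet> score n (\<lambda>i. x i \<omega>) (\<lambda>i. \<epsilon> i \<omega>)) \<partial>M)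
      \<longlonglongrightarrow> (\<integral>z. iexp (t \<bullet> z) \<partial>multi_normal 0 (\<sigma>\<^sup>2 *\<^sub>R C))" for t
    using char_score_tendsto[OF model gram, of t]
    by (simp add: multi_normal_char(3)[OF root] scaleR_matrix_vector_assoc[symmetric])
  obtain K where K: "K > 0" "\<forall>\<^sub>F n in sequentially.
      measure M {\<omega>\<in>space M. norm (score n (\<lambda>i. x i \<omega>) (\<lambda>i. \<epsilon> i \<omega>)) > K} < \<delta> / 2"
    using tight_if_char_tendsto[OF prob_space_axioms multi_normal_char(1)[OF root] multi_normal_char(2)[OF root] _ char, of "\<delta> / 2"]
      \<open>\<delta> > 0\<close> by auto
  have "\<forall>\<^sub>F n in sequentially. measure M (bad_event M x \<epsilon> C \<eta> K n) < \<delta>" if "\<eta> > 0" for \<eta>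
  proof -
    define A where "A n = {\<omega>\<in>space M. \<exists>j k. \<bar>((1 / real n) *\<^sub>R gram n (\<lambda>i. x i \<omega>)) $ j $ k - C $ j $ k\<bar> > \<eta>}" for n
    have [measurable]: "A n \<in> sets M" for n unfolding A_def by measurable
    have "(\<lambda>n. \<integral>\<omega>. indicator (A n) \<omega> \<partial>M) \<longlonglongrightarrow> (\<integral>\<omega>. (0::real) \<partial>M)"
    proof (rule integral_dominated_convergence[where w = "\<lambda>_. 1"])
      show "AE \<omega> in M. (\<lambda>n. indicator (A n) \<omega> :: real) \<longlonglongrightarrow> 0"
        using gram
      proof eventually_elim
        case (elim \<omega>)
        have "\<forall>\<^sub>F n in sequentially. \<forall>j\<in>UNIV. \<forall>k\<in>UNIV. \<bar>((1 / real n) *\<^sub>R gram n (\<lambda>i. x i \<omega>)) $ j $ k - C $ j $ k\<bar> < \<eta>"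
        proof (intro eventually_ball_finite ballI finite)
          fix j k
          have "(\<lambda>n. ((1 / real n) *\<^sub>R gram n (\<lambda>i. x i \<omega>)) $ j $ k) \<longlonglongrightarrow> C $ j $ k"
            by (intro tendsto_vec_nth elim)
          from tendstoD[OF this that]
          show "\<forall>\<^sub>F n in sequentially. \<bar>((1 / real n) *\<^sub>R gram n (\<lambda>i. x i \<omega>)) $ j $ k - C $ j $ k\<bar> < \<eta>"
            unfolding dist_real_def .
        qed
        then show ?case
        proof (intro tendsto_eventually, eventually_elim)
          case (elim n)
          then have "\<omega> \<notin> A n" unfolding A_def by (auto simp: not_less intro: less_imp_le)
          then show ?case by simp
        qed
      qed
    qed auto
    then have "(\<lambda>n. measure M (A n)) \<longlonglongrightarrow> 0" by simp
    then have "\<forall>\<^sub>F n in sequentially. measure M (A n) < \<delta> / 2"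
      using \<open>\<delta> > 0\<close> by (intro order_tendstoD(2)) auto
    with K(2) show ?thesis
    proof eventually_elim
      case (elim n)
      have "measure M (bad_event M x \<epsilon> C \<eta> K n)
          \<le> measure M {\<omega>\<in>space M. norm (score n (\<lambda>i. x i \<omega>) (\<lambda>i. \<epsilon> i \<omega>)) > K} + measure M (A n)"
        unfolding bad_event_def A_def[symmetric] by (rule measure_Un_le) measurable
      with elim show ?case by linarith
    qed
  qed
  with K(1) show ?thesis by blast
qed

text \<open>
  Both asymptotic statements follow from this one: off an event of arbitrarily small
  probability, zero coefficients are estimated by \<open>0\<close> and the others solve the normal equations up to an
  arbitrarily small error.
\<close>
lemma one_step_selection_off_bad_event:
  fixes x :: "nat \<Rightarrow> 'a \<Rightarrow> real^'p"
  assumes model: "linear_model M x \<epsilon> y \<beta>\<^sub>0 \<sigma>"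
    and gram: "AE \<omega> in M. (\<lambda>n. (1 / real n) *\<^sub>R gram n (\<lambda>i. x i \<omega>)) \<longlonglongrightarrow> C"
    and C: "pos_definite C" and ols: "ols_estimator M x y b0"
    and P: "separating_penalties P" and ose: "one_step_estimator M x y P b0 b"
    and "\<tau> > 0" "\<delta> > 0"
  obtains B where "\<And>n. B n \<in> sets M" "\<forall>\<^sub>F n in sequentially. measure M (B n) < \<delta>"
    "\<forall>\<^sub>F n in sequentially. AE \<omega> in M. \<omega> \<notin> B n \<longrightarrow>
      (\<forall>j. if \<beta>\<^sub>0 $ j = 0 then b n \<omega> $ j = 0
        else \<bar>(C *v scaled_error n \<beta>\<^sub>0 (b n \<omega>)) $ j - score n (\<lambda>i. x i \<omega>) (\<lambda>i. \<epsilon> i \<omega>) $ j\<bar> \<le> \<tau>)"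
proof -
  obtain K where K: "K > 0" "\<And>\<eta>. \<eta> > 0 \<Longrightarrow> \<forall>\<^sub>F n in sequentially. measure M (bad_event M x \<epsilon> C \<eta> K n) < \<delta>"
    using bad_event_small[OF model gram C \<open>\<delta> > 0\<close>] by blast
  obtain \<eta> where \<eta>: "\<eta> > 0" and ev: "\<forall>\<^sub>F n in sequentially. \<forall>x \<epsilon> y b0 b.
    (\<forall>i. y i = x i \<bullet> \<beta>\<^sub>0 + \<epsilon> i) \<longrightarrow>
    is_arg_min (rss n x y) (\<lambda>_. True) b0 \<longrightarrow>
    is_arg_min (one_step_objective n x y (P n) b0) (\<lambda>_. True) b \<longrightarrow>
    (\<forall>j k. \<bar>((1 / real n) *\<^sub>R gram n x) $ j $ k - C $ j $ k\<bar> \<le> \<eta>) \<longrightarrow>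
    norm (score n x \<epsilon>) \<le> K \<longrightarrow>
    (\<forall>j. if \<beta>\<^sub>0 $ j = 0 then b $ j = 0
      else \<bar>(C *v scaled_error n \<beta>\<^sub>0 b) $ j - score n x \<epsilon> $ j\<bar> \<le> \<tau>)"
    using one_step_eventually_selection[OF C P less_imp_le[OF K(1)] \<open>\<tau> > 0\<close>] by blast
  show thesis
  proof
    show "bad_event M x \<epsilon> C \<eta> K n \<in> sets M" for n by (rule bad_event_measurable[OF model])
    show "\<forall>\<^sub>F n in sequentially. measure M (bad_event M x \<epsilon> C \<eta> K n) < \<delta>" by (rule K(2)[OF \<eta>])
    show "\<forall>\<^sub>F n in sequentially. AE \<omega> in M. \<omega> \<notin> bad_event M x \<epsilon> C \<eta> K n \<longrightarrow>
      (\<forall>j. if \<beta>\<^sub>0 $ j = 0 then b n \<omega> $ j = 0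
        else \<bar>(C *v scaled_error n \<beta>\<^sub>0 (b n \<omega>)) $ j - score n (\<lambda>i. x i \<omega>) (\<lambda>i. \<epsilon> i \<omega>) $ j\<bar> \<le> \<tau>)"
      using ev
    proof eventually_elim
      case (elim n)
      note selection = elim
      have "AE \<omega> in M. is_arg_min (rss n (\<lambda>i. x i \<omega>) (\<lambda>i. y i \<omega>)) (\<lambda>_. True) (b0 n \<omega>)"
        using ols by (simp add: ols_estimator_def)
      moreover have "AE \<omega> in M. is_arg_min
          (one_step_objective n (\<lambda>i. x i \<omega>) (\<lambda>i. y i \<omega>) (P n) (b0 n \<omega>)) (\<lambda>_. True) (b n \<omega>)"
        using ose by (simp add: one_step_estimator_def)
      moreover have "AE \<omega> in M. \<omega> \<in> space M" by simp
      ultimately show ?case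
      proof eventually_elim
        case (elim \<omega>)
        have y: "\<forall>i. y i \<omega> = x i \<omega> \<bullet> \<beta>\<^sub>0 + \<epsilon> i \<omega>"
          using model elim(3) by (simp add: linear_model_def)
        show ?case
        proof
          assume "\<omega> \<notin> bad_event M x \<epsilon> C \<eta> K n"
          then have "\<forall>j k. \<bar>((1 / real n) *\<^sub>R gram n (\<lambda>i. x i \<omega>)) $ j $ k - C $ j $ k\<bar> \<le> \<eta>"
              "norm (score n (\<lambda>i. x i \<omega>) (\<lambda>i. \<epsilon> i \<omega>)) \<le> K"
            using elim(3) unfolding bad_event_def by (auto simp: not_less simp del: vector_scaleR_component)
          with selection[THEN spec[of _ "\<lambda>i. x i \<omega>"], THEN spec[of _ "\<lambda>i. \<epsilon> i \<omega>"],
              THEN spec[of _ "\<lambda>i. y i \<omega>"], THEN spec[of _ "b0 n \<omega>"], THEN spec[of _ "b n \<omega>"]] y elim(1,2)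
          show "\<forall>j. if \<beta>\<^sub>0 $ j = 0 then b n \<omega> $ j = 0
            else \<bar>(C *v scaled_error n \<beta>\<^sub>0 (b n \<omega>)) $ j - score n (\<lambda>i. x i \<omega>) (\<lambda>i. \<epsilon> i \<omega>) $ j\<bar> \<le> \<tau>"
            by blast
        qed
      qed
    qed
  qed
qed

section \<open>Sparsity and asymptotic normality\<close>

lemma sparsity_of_one_step:
  fixes x :: "nat \<Rightarrow> 'a \<Rightarrow> real^'p"
  assumes model: "linear_model M x \<epsilon> y \<beta>\<^sub>0 \<sigma>"
    and gram: "AE \<omega> in M. (\<lambda>n. (1 / real n) *\<^sub>R gram n (\<lambda>i. x i \<omega>)) \<longlonglongrightarrow> C"
    and C: "pos_definite C" and ols: "ols_estimator M x y b0"
    and P: "separating_penalties P" and ose: "one_step_estimator M x y P b0 b"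
  shows "sparsity M \<beta>\<^sub>0 b"
  unfolding sparsity_def
proof (rule tendstoI)
  interpret prob_space M using model by (simp add: linear_model_def)
  have b[measurable]: "b n \<in> borel_measurable M" for n using ose by (simp add: one_step_estimator_def)
  have [measurable]: "(\<lambda>\<omega>. b n \<omega> $ j) \<in> borel_measurable M" for n j
    by (rule borel_measurable_continuous_on[of "\<lambda>v. v $ j"]) (auto intro!: continuous_intros)
  let ?S = "\<lambda>n. {\<omega>\<in>space M. \<forall>j. \<beta>\<^sub>0 $ j = 0 \<longrightarrow> b n \<omega> $ j = 0}"
  fix \<delta> :: real assume "\<delta> > 0"
  obtain B where B: "\<And>n. B n \<in> sets M" "\<forall>\<^sub>F n in sequentially. measure M (B n) < \<delta>"
    "\<forall>\<^sub>F n in sequentially. AE \<omega> in M. \<omega> \<notin> B n \<longrightarrow>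
      (\<forall>j. if \<beta>\<^sub>0 $ j = 0 then b n \<omega> $ j = 0
        else \<bar>(C *v scaled_error n \<beta>\<^sub>0 (b n \<omega>)) $ j - score n (\<lambda>i. x i \<omega>) (\<lambda>i. \<epsilon> i \<omega>) $ j\<bar> \<le> 1)"
    using one_step_selection_off_bad_event[OF model gram C ols P ose zero_less_one \<open>\<delta> > 0\<close>] by blast
  from B(2,3) show "\<forall>\<^sub>F n in sequentially. dist (measure M (?S n)) 1 < \<delta>"
  proof eventually_elim
    case (elim n)
    have "AE \<omega> in M. \<omega> \<in> space M - B n \<longrightarrow> \<omega> \<in> ?S n"
      using elim(2)
    proof eventually_elim
      case (elim \<omega>)
      show ?case
      proof
        assume "\<omega> \<in> space M - B n"
        with elim show "\<omega> \<in> ?S n" by (auto split: if_splits)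
      qed
    qed
    then have "measure M (space M - B n) \<le> measure M (?S n)"
      by (intro finite_measure_mono_AE) auto
    also have "measure M (space M - B n) = 1 - measure M (B n)" by (rule prob_compl) fact
    finally show ?case using elim(1) prob_le_1[of "?S n"] by (simp add: dist_real_def)
  qed
qed

text \<open>
  The adjoint of \<open>subvec e\<close>; for injective \<open>e\<close> it extends a vector by zeros outside the range of \<open>e\<close>.
\<close>
definition zero_extend :: "('q::finite \<Rightarrow> 'p) \<Rightarrow> real^'q \<Rightarrow> real^'p" where
  "zero_extend e v = (\<chi> j. \<Sum>i\<in>UNIV. if e i = j then v $ i else 0)"

lemma inner_zero_extend: "zero_extend e v \<bullet> w = v \<bullet> subvec e w"
proof -
  have "zero_extend e v \<bullet> w = (\<Sum>j\<in>UNIV. \<Sum>i\<in>UNIV. if e i = j then v $ i * w $ j else 0)"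
    by (simp add: inner_vec_def zero_extend_def sum_distrib_right if_distrib[of "\<lambda>a. a * _"] cong: if_cong)
  also have "\<dots> = (\<Sum>i\<in>UNIV. \<Sum>j\<in>UNIV. if e i = j then v $ i * w $ j else 0)" by (rule sum.swap)
  finally show ?thesis by (simp add: inner_vec_def subvec_def)
qed

lemma submat_mult: "submat e C *v v = subvec e (C *v zero_extend e v)"
proof -
  have "(\<Sum>j\<in>UNIV. C $ l $ j * zero_extend e v $ j) = (\<Sum>i\<in>UNIV. C $ l $ e i * v $ i)" for l
    using inner_zero_extend[of e v "C $ l"] by (simp add: inner_vec_def subvec_def mult.commute)
  then show ?thesis by (simp add: vec_eq_iff submat_def subvec_def matrix_vector_mult_def)
qed

lemma zero_extend_subvec:
  assumes "inj e" "\<And>j. j \<notin> range e \<Longrightarrow> w $ j = 0"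
  shows "zero_extend e (subvec e w) = w"
proof -
  have "(\<Sum>i\<in>UNIV. if e i = j then w $ e i else 0) = w $ j" for j
  proof (cases "j \<in> range e")
    case True
    then obtain i where i: "j = e i" by blast
    have "(\<Sum>i\<in>UNIV. if e i = j then w $ e i else 0) = (\<Sum>i'\<in>UNIV. if i' = i then w $ e i else 0)"
      using assms(1) by (intro sum.cong refl) (auto simp: i dest: injD)
    then show ?thesis by (simp add: i)
  next
    case False
    then have "(\<Sum>i\<in>UNIV. if e i = j then w $ e i else 0) = 0" by (intro sum.neutral) auto
    then show ?thesis using assms(2)[OF False] by simp
  qed
  then show ?thesis by (simp add: vec_eq_iff zero_extend_def subvec_def cong: if_cong)
qed

lemma pos_definite_submat:
  assumes "pos_definite C" "inj e"
  shows "pos_definite (submat e C)"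
  unfolding pos_definite_def
proof (intro conjI allI impI)
  have "C $ j $ k = C $ k $ j" for j k
    using assms(1) unfolding pos_definite_def by (metis transpose_def vec_lambda_beta)
  then show "transpose (submat e C) = submat e C" by (simp add: submat_def transpose_def vec_eq_iff)
  fix v :: "real^'b" assume "v \<noteq> 0"
  have "subvec e (zero_extend e v) = v"
    using assms(2) by (simp add: vec_eq_iff subvec_def zero_extend_def inj_eq)
  moreover have "subvec e 0 = 0" by (simp add: subvec_def vec_eq_iff)
  ultimately have "zero_extend e v \<noteq> 0" using \<open>v \<noteq> 0\<close> by metis
  then have "zero_extend e v \<bullet> (C *v zero_extend e v) > 0" using assms(1) by (simp add: pos_definite_def)
  then show "v \<bullet> (submat e C *v v) > 0" by (simp add: submat_mult inner_zero_extend)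
qed

lemma norm_iexp_diff_le: "norm (iexp a - iexp b) \<le> \<bar>a - b\<bar>"
proof -
  have "iexp a - iexp b = iexp b * (iexp (a - b) - 1)"
    by (simp add: exp_add[symmetric] algebra_simps)
  then have "norm (iexp a - iexp b) = norm (iexp (a - b) - 1)" by (simp add: norm_mult)
  also have "\<dots> \<le> \<bar>a - b\<bar>" using iexp_approx1[of "a - b" 0] by simp
  finally show ?thesis .
qed

text \<open>
  Off the bad event the approximate normal equations read \<open>C1 *v Z \<approx> subvec e W\<close>, because the other
  coordinates vanish. Testing against \<open>q = D *v t\<close>, with \<open>D\<close> the inverse of \<open>C1\<close>, shows that \<open>t \<bullet> Z\<close> is
  close to \<open>zero_extend e q \<bullet> W\<close>, a direction of the score, whose characteristic function has the limit
  given by the quadratic form \<open>q \<bullet> (C1 *v q) = t \<bullet> (D *v t)\<close>.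
\<close>
lemma asymptotic_normality_of_one_step:
  fixes x :: "nat \<Rightarrow> 'a \<Rightarrow> real^'p" and e :: "'q::finite \<Rightarrow> 'p"
  assumes model: "linear_model M x \<epsilon> y \<beta>\<^sub>0 \<sigma>"
    and gram: "AE \<omega> in M. (\<lambda>n. (1 / real n) *\<^sub>R gram n (\<lambda>i. x i \<omega>)) \<longlonglongrightarrow> C"
    and C: "pos_definite C" and ols: "ols_estimator M x y b0"
    and P: "separating_penalties P" and ose: "one_step_estimator M x y P b0 b"
  shows "asymptotic_normality e M \<beta>\<^sub>0 \<sigma> C b"
  unfolding asymptotic_normality_def
proof (rule impI)
  interpret prob_space M using model by (simp add: linear_model_def)
  note meas_model[measurable] = linear_model_measurable[OF model]
  have b[measurable]: "b n \<in> borel_measurable M" for n using ose by (simp add: one_step_estimator_def)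
  assume "bij_betw e UNIV {j. \<beta>\<^sub>0 $ j \<noteq> 0}"
  then have e: "inj e" "range e = {j. \<beta>\<^sub>0 $ j \<noteq> 0}" by (auto simp: bij_betw_def)
  define C1 where "C1 = submat e C"
  have C1: "pos_definite C1" unfolding C1_def by (rule pos_definite_submat[OF C e(1)])
  obtain V :: "real^'q^'q" where V: "(V ** transpose V) ** C1 = mat 1" "C1 ** (V ** transpose V) = mat 1"
    using pos_definite_inverse_factorization[OF C1] by blast
  define D where "D = V ** transpose V"
  have D: "matrix_inv C1 = D" using V(1) unfolding D_def by (rule matrix_inv_eqI)
  have DC: "D *v (C1 *v v) = v" "C1 *v (D *v v) = v" for v
    using V by (simp_all add: D_def matrix_vector_mul_assoc)
  have symD: "transpose D = D" by (simp add: D_def matrix_transpose_mul)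
  have root: "(\<sigma> *\<^sub>R V) ** transpose (\<sigma> *\<^sub>R V) = \<sigma>\<^sup>2 *\<^sub>R D" by (simp add: scaled_factorization D_def)
  define Z where "Z n \<omega> = sqrt (real n) *\<^sub>R (subvec e (b n \<omega>) - subvec e \<beta>\<^sub>0)" for n \<omega>
  define W where "W n \<omega> = score n (\<lambda>i. x i \<omega>) (\<lambda>i. \<epsilon> i \<omega>)" for n \<omega>
  have [measurable]: "W n \<in> borel_measurable M" for n unfolding W_def by (rule meas_model)
  have Z[measurable]: "Z n \<in> borel_measurable M" for n
  proof -
    have [measurable]: "(\<lambda>\<omega>. subvec e (b n \<omega>)) \<in> borel_measurable M"
      unfolding subvec_def
      by (rule borel_measurable_continuous_on[of "\<lambda>v. \<chi> i. v $ e i"]) (auto intro!: continuous_intros)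
    show ?thesis unfolding Z_def by measurable
  qed
  have "(\<lambda>n. \<integral>\<omega>. iexp (t \<bullet> Z n \<omega>) \<partial>M) \<longlonglongrightarrow> (\<integral>z. iexp (t \<bullet> z) \<partial>multi_normal 0 (\<sigma>\<^sup>2 *\<^sub>R D))" for t
  proof -
    define q where "q = D *v t"
    have q: "q \<bullet> (C1 *v w) = t \<bullet> w" for w
    proof -
      have "q \<bullet> (C1 *v w) = t \<bullet> (D *v (C1 *v w))"
        using inner_matrix_vector_mult[of t D "C1 *v w"] symD by (simp add: q_def)
      then show ?thesis by (simp add: DC)
    qed
    define c where "c = (\<Sum>i\<in>UNIV. \<bar>q $ i\<bar>)"
    have "c \<ge> 0" by (simp add: c_def sum_nonneg)
    have "zero_extend e q \<bullet> (C *v zero_extend e q) = t \<bullet> (D *v t)"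
      unfolding inner_zero_extend submat_mult[symmetric] C1_def[symmetric] q by (simp add: q_def)
    then have "(\<lambda>n. \<integral>\<omega>. iexp (zero_extend e q \<bullet> W n \<omega>) \<partial>M) \<longlonglongrightarrow> (\<integral>z. iexp (t \<bullet> z) \<partial>multi_normal 0 (\<sigma>\<^sup>2 *\<^sub>R D))"
      using char_score_tendsto[OF model gram, of "zero_extend e q"]
      by (simp add: W_def multi_normal_char(3)[OF root] scaleR_matrix_vector_assoc[symmetric])
    moreover have "(\<lambda>n. (\<integral>\<omega>. iexp (t \<bullet> Z n \<omega>) \<partial>M) - (\<integral>\<omega>. iexp (zero_extend e q \<bullet> W n \<omega>) \<partial>M)) \<longlonglongrightarrow> 0"
    proof (rule tendstoI)
      fix \<delta> :: real assume "\<delta> > 0"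
      define \<tau> where "\<tau> = \<delta> / (2 * (c + 1))"
      have \<tau>: "\<tau> > 0" "c * \<tau> \<le> \<delta> / 2" using \<open>\<delta> > 0\<close> \<open>c \<ge> 0\<close> by (auto simp: \<tau>_def field_simps)
      have "\<delta> / 4 > 0" using \<open>\<delta> > 0\<close> by simp
      obtain B where B: "\<And>n. B n \<in> sets M" "\<forall>\<^sub>F n in sequentially. measure M (B n) < \<delta> / 4"
        "\<forall>\<^sub>F n in sequentially. AE \<omega> in M. \<omega> \<notin> B n \<longrightarrow>
          (\<forall>j. if \<beta>\<^sub>0 $ j = 0 then b n \<omega> $ j = 0
            else \<bar>(C *v scaled_error n \<beta>\<^sub>0 (b n \<omega>)) $ j - score n (\<lambda>i. x i \<omega>) (\<lambda>i. \<epsilon> i \<omega>) $ j\<bar> \<le> \<tau>)"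
        using one_step_selection_off_bad_event[OF model gram C ols P ose \<tau>(1) \<open>\<delta> / 4 > 0\<close>] by blast
      from B(2,3) show "\<forall>\<^sub>F n in sequentially.
        dist ((\<integral>\<omega>. iexp (t \<bullet> Z n \<omega>) \<partial>M) - (\<integral>\<omega>. iexp (zero_extend e q \<bullet> W n \<omega>) \<partial>M)) 0 < \<delta>"
      proof eventually_elim
        case (elim n)
        have "norm ((\<integral>\<omega>. iexp (t \<bullet> Z n \<omega>) \<partial>M) - (\<integral>\<omega>. iexp (zero_extend e q \<bullet> W n \<omega>) \<partial>M)) \<le> c * \<tau> + 2 * measure M (B n)"
        proof (rule integral_diff_le_off_event)
          show "integrable M (\<lambda>\<omega>. iexp (t \<bullet> Z n \<omega>))" "integrable M (\<lambda>\<omega>. iexp (zero_extend e q \<bullet> W n \<omega>))"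
            by (auto intro!: integrable_iexp)
          show "AE \<omega> in M. norm (iexp (t \<bullet> Z n \<omega>) - iexp (zero_extend e q \<bullet> W n \<omega>)) \<le> 2"
            by (intro AE_I2 norm_triangle_le_diff) simp
          show "AE \<omega> in M. \<omega> \<notin> B n \<longrightarrow> norm (iexp (t \<bullet> Z n \<omega>) - iexp (zero_extend e q \<bullet> W n \<omega>)) \<le> c * \<tau>"
            using elim(2)
          proof eventually_elim
            case (elim \<omega>)
            show ?case
            proof
              assume "\<omega> \<notin> B n"
              define u where "u = scaled_error n \<beta>\<^sub>0 (b n \<omega>)"
              have zero: "u $ j = 0" if "j \<notin> range e" for j
                using elim \<open>\<omega> \<notin> B n\<close> that e(2) by (auto simp: u_def scaled_error_def split: if_splits)
              have stat: "\<bar>(C *v u) $ e i - W n \<omega> $ e i\<bar> \<le> \<tau>" for i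
                using elim \<open>\<omega> \<notin> B n\<close> e(2) by (auto simp: u_def W_def split: if_splits)
              have "Z n \<omega> = subvec e u"
                by (simp add: Z_def u_def scaled_error_def subvec_def vec_eq_iff)
              then have "t \<bullet> Z n \<omega> = q \<bullet> subvec e (C *v u)"
                using zero_extend_subvec[OF e(1) zero] by (simp add: q[symmetric] C1_def submat_mult)
              then have "t \<bullet> Z n \<omega> - zero_extend e q \<bullet> W n \<omega> = (\<Sum>i\<in>UNIV. q $ i * ((C *v u) $ e i - W n \<omega> $ e i))"
                unfolding inner_zero_extend by (simp add: inner_vec_def[of q] subvec_def sum_subtractf right_diff_distrib)
              then have "\<bar>t \<bullet> Z n \<omega> - zero_extend e q \<bullet> W n \<omega>\<bar> \<le> (\<Sum>i\<in>UNIV. \<bar>q $ i\<bar> * \<bar>(C *v u) $ e i - W n \<omega> $ e i\<bar>)"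
                by (simp add: sum_abs[THEN order_trans] abs_mult)
              also have "\<dots> \<le> (\<Sum>i\<in>UNIV. \<bar>q $ i\<bar> * \<tau>)"
                using stat by (intro sum_mono mult_left_mono) auto
              also have "\<dots> = c * \<tau>" by (simp add: c_def sum_distrib_right)
              finally show "norm (iexp (t \<bullet> Z n \<omega>) - iexp (zero_extend e q \<bullet> W n \<omega>)) \<le> c * \<tau>"
                using norm_iexp_diff_le order_trans by blast
            qed
          qed
        qed (use B(1) \<open>c \<ge> 0\<close> \<tau>(1) in auto)
        with elim(1) \<tau>(2) show ?case by simp
      qed
    qed
    ultimately show ?thesis by (rule Lim_transform)
  qed
  then have "conv_in_distribution M Z (multi_normal 0 (\<sigma>\<^sup>2 *\<^sub>R D))"
    by (intro conv_in_distribution_if_char_tendsto prob_space_axioms multi_normal_char[OF root] Z)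
  then show "conv_in_distribution M (\<lambda>n \<omega>. sqrt (real n) *\<^sub>R (subvec e (b n \<omega>) - subvec e \<beta>\<^sub>0))
      (multi_normal 0 (\<sigma>\<^sup>2 *\<^sub>R matrix_inv (submat e C)))"
    unfolding D[unfolded C1_def] Z_def .
qed

section \<open>Penalties that separate zero from nonzero coefficients\<close>

lemma eventually_sqrt_gt: "\<forall>\<^sub>F n in sequentially. sqrt (real n) > B"
  using filterlim_compose[OF sqrt_at_top filterlim_real_sequentially]
  by (auto simp: filterlim_at_top_dense)

lemma eventually_local_window:
  assumes "d > 0"
  shows "\<forall>\<^sub>F n in sequentially. \<forall>z. sqrt (real n) * z \<le> R \<longrightarrow> z < d"
  using eventually_sqrt_gt[of "R / d"] eventually_gt_at_top[of 0]
proof eventually_elim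
  case (elim n)
  have "R < sqrt (real n) * d" using elim(1) assms by (simp add: pos_divide_less_eq)
  then have "sqrt (real n) * z < sqrt (real n) * d" if "sqrt (real n) * z \<le> R" for z using that by linarith
  then show ?case using elim(2) by simp
qed

text \<open>
  The SCAD derivative is constantly \<open>lam n\<close> up to \<open>lam n\<close>, which exceeds every multiple of
  \<open>1 / sqrt n\<close> eventually, and it vanishes from \<open>a * lam n\<close> on, which tends to \<open>0\<close>.
\<close>
lemma separating_penalties_scad:
  assumes "a > 2" and pos: "\<And>n. lam n > 0"
    and large: "filterlim (\<lambda>n. sqrt (real n) * lam n) at_top sequentially" and small: "lam \<longlonglongrightarrow> 0"
  shows "separating_penalties (\<lambda>n. scad a (lam n))"
  unfolding separating_penalties_def
proof (intro conjI allI impI)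
  note pd = pen_deriv_scad[OF \<open>a > 2\<close> pos]
  show "pen_deriv (scad a (lam n)) \<theta> \<ge> 0" if "\<theta> \<ge> 0" for n \<theta>
    using that assms(1) pos[of n] by (simp add: pd scad_deriv_alt)
  have gt: "\<forall>\<^sub>F n in sequentially. sqrt (real n) * lam n > B" for B
    using large by (auto simp: filterlim_at_top_dense)
  show "\<forall>\<^sub>F n in sequentially. \<forall>\<theta>. 0 \<le> \<theta> \<and> sqrt (real n) * \<theta> \<le> R \<longrightarrow>
      ereal L < ereal (sqrt (real n)) * pen_deriv (scad a (lam n)) \<theta>" for R L
    using gt[of R] gt[of L] eventually_gt_at_top[of 0]
  proof eventually_elim
    case (elim n)
    show ?case
    proof (intro allI impI)
      fix \<theta> assume \<theta>: "0 \<le> \<theta> \<and> sqrt (real n) * \<theta> \<le> R"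
      then have "sqrt (real n) * \<theta> < sqrt (real n) * lam n" using elim(1) by linarith
      then have "\<theta> \<le> lam n" using elim(3) by simp
      then show "ereal L < ereal (sqrt (real n)) * pen_deriv (scad a (lam n)) \<theta>"
        using elim(2) \<theta> pos[of n] by (simp add: pd scad_deriv_def)
    qed
  qed
  show "\<forall>\<^sub>F n in sequentially. \<forall>\<theta>\<ge>0. sqrt (real n) * \<bar>\<theta> - \<theta>\<^sub>0\<bar> \<le> R \<longrightarrow>
      ereal (sqrt (real n)) * pen_deriv (scad a (lam n)) \<theta> \<le> ereal \<delta>"
    if "\<theta>\<^sub>0 > 0 \<and> \<delta> > 0" for \<theta>\<^sub>0 R \<delta>
  proof -
    have "(\<lambda>n. a * lam n) \<longlonglongrightarrow> a * 0" by (intro tendsto_intros small)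
    then have "\<forall>\<^sub>F n in sequentially. a * lam n < \<theta>\<^sub>0 / 2"
      using that by (intro order_tendstoD(2)) auto
    moreover have "\<forall>\<^sub>F n in sequentially. \<forall>z. sqrt (real n) * z \<le> R \<longrightarrow> z < \<theta>\<^sub>0 / 2"
      using that by (intro eventually_local_window) auto
    ultimately show ?thesis
    proof eventually_elim
      case (elim n)
      show ?case
      proof (intro allI impI)
        fix \<theta> :: real assume "\<theta> \<ge> 0" "sqrt (real n) * \<bar>\<theta> - \<theta>\<^sub>0\<bar> \<le> R"
        with elim(2) have "\<bar>\<theta> - \<theta>\<^sub>0\<bar> < \<theta>\<^sub>0 / 2" by blast
        then have "a * lam n < \<theta>" using elim(1) by linarith
        moreover have "lam n \<le> a * lam n" using \<open>a > 2\<close> pos[of n] by simp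
        ultimately have "scad_deriv a (lam n) \<theta> = 0" by (simp add: scad_deriv_def)
        then show "ereal (sqrt (real n)) * pen_deriv (scad a (lam n)) \<theta> \<le> ereal \<delta>"
          using that \<open>\<theta> \<ge> 0\<close> by (simp add: pd)
      qed
    qed
  qed
qed

text \<open>
  If \<open>\<theta> \<le> R / sqrt n\<close> then \<open>deriv p \<theta>\<close> is at least of the order \<open>\<theta> powr (- s)\<close>, hence of the order
  \<open>n powr (s / 2)\<close>; multiplied by \<open>sqrt n * lam n\<close> this is the rate assumed to diverge. Near a positive
  number \<open>deriv p\<close> is bounded by continuity, and \<open>sqrt n * lam n\<close> tends to \<open>0\<close>.
\<close>
lemma separating_penalties_power_singularity:
  fixes p :: "real \<Rightarrow> real"
  assumes pos: "\<And>n. lam n > 0"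
    and mono: "mono_on {0<..} p" and diff: "p differentiable_on {0<..}"
    and cont: "continuous_on {0<..} (deriv p)" and "s > 0"
    and theta: "deriv p \<in> \<Theta>[at_right 0](\<lambda>\<theta>. \<theta> powr (- s))"
    and large: "filterlim (\<lambda>n. real n powr ((1 + s) / 2) * lam n) at_top sequentially"
    and small: "(\<lambda>n. sqrt (real n) * lam n) \<longlonglongrightarrow> 0"
  shows "separating_penalties (\<lambda>n \<theta>. lam n * p \<theta>)"
proof -
  have DERIV: "(p has_real_derivative deriv p \<theta>) (at \<theta>)" if "\<theta> > 0" for \<theta>
  proof -
    have "p differentiable (at \<theta>)"
      using diff that by (simp add: differentiable_on_eq_differentiable_at)
    then show ?thesis by (simp add: DERIV_deriv_iff_real_differentiable)
  qed
  have deriv_nonneg: "deriv p \<theta> \<ge> 0" if "\<theta> > 0" for \<theta>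
    using mono_on_imp_deriv_nonneg[OF mono DERIV[OF that]] that by (simp add: interior_open)
  have deriv_cmult: "deriv (\<lambda>\<theta>. lam n * p \<theta>) \<theta> = lam n * deriv p \<theta>" if "\<theta> > 0" for n \<theta>
    by (rule DERIV_imp_deriv[OF DERIV_cmult[OF DERIV[OF that]]])
  have pd: "pen_deriv (\<lambda>\<theta>. lam n * p \<theta>) \<theta> = ereal (lam n * deriv p \<theta>)" if "\<theta> > 0" for n \<theta>
    using that by (simp add: pen_deriv_def deriv_cmult)
  obtain c where c: "c > 0" "\<forall>\<^sub>F \<theta> in at_right 0. norm (deriv p \<theta>) \<ge> c * norm (\<theta> powr (- s))"
    using landau_omega.bigE[OF bigthetaD2[OF theta]] by blast
  then obtain d where d: "d > 0" "\<And>\<theta>. 0 < \<theta> \<Longrightarrow> \<theta> < d \<Longrightarrow> deriv p \<theta> \<ge> c * \<theta> powr (- s)"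
    using deriv_nonneg unfolding eventually_at_right_field by force
  have pd0: "pen_deriv (\<lambda>\<theta>. lam n * p \<theta>) 0 = \<infinity>" for n
  proof -
    have "filterlim (\<lambda>\<theta>. lam n * (c * \<theta> powr (- s))) at_top (at_right 0)"
    proof -
      have "filterlim (\<lambda>\<theta>::real. \<theta> powr (- s)) at_top (at_right 0)"
        using \<open>s > 0\<close> by real_asymp
      then show ?thesis using c(1) pos[of n]
        by (intro filterlim_tendsto_pos_mult_at_top[OF tendsto_const]) auto
    qed
    moreover have "\<forall>\<^sub>F \<theta> in at_right 0. lam n * (c * \<theta> powr (- s)) \<le> deriv (\<lambda>\<theta>. lam n * p \<theta>) \<theta>"
      unfolding eventually_at_right_field
      using d pos[of n] by (intro exI[of _ d]) (auto simp: deriv_cmult)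
    ultimately have "filterlim (deriv (\<lambda>\<theta>. lam n * p \<theta>)) at_top (at_right 0)"
      by (rule filterlim_at_top_mono)
    then have "((\<lambda>\<theta>. ereal (deriv (\<lambda>\<theta>. lam n * p \<theta>) \<theta>)) \<longlongrightarrow> \<infinity>) (at_right 0)"
      by (simp add: tendsto_PInfty_eq_at_top)
    then show ?thesis by (simp add: pen_deriv_def tendsto_Lim)
  qed
  show ?thesis
    unfolding separating_penalties_def
  proof (intro conjI allI impI)
    show "pen_deriv (\<lambda>\<theta>. lam n * p \<theta>) \<theta> \<ge> 0" if "\<theta> \<ge> 0" for n \<theta>
      using that deriv_nonneg[of \<theta>] pos[of n] pd[of \<theta> n] pd0[of n] by (cases "\<theta> = 0") auto
    show "\<forall>\<^sub>F n in sequentially. \<forall>\<theta>. 0 \<le> \<theta> \<and> sqrt (real n) * \<theta> \<le> R \<longrightarrow>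
        ereal L < ereal (sqrt (real n)) * pen_deriv (\<lambda>\<theta>. lam n * p \<theta>) \<theta>" for R L
    proof -
      \<comment> \<open>a positive bound, needed for the negative power below\<close>
      define R' where "R' = max R 1"
      have R': "R' > 0" by (simp add: R'_def)
      define r where "r = c * R' powr (- s)"
      have r: "r > 0" using c(1) R' by (simp add: r_def)
      have "\<forall>\<^sub>F n in sequentially. real n powr ((1 + s) / 2) * lam n > L / r"
        using large by (auto simp: filterlim_at_top_dense)
      then show ?thesis
        using eventually_local_window[OF d(1), of R'] eventually_gt_at_top[of 0]
      proof eventually_elim
        case (elim n)
        show ?case
        proof (intro allI impI)
          fix \<theta> assume \<theta>: "0 \<le> \<theta> \<and> sqrt (real n) * \<theta> \<le> R"
          show "ereal L < ereal (sqrt (real n)) * pen_deriv (\<lambda>\<theta>. lam n * p \<theta>) \<theta>"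
          proof (cases "\<theta> = 0")
            case True
            then show ?thesis using elim(3) by (simp add: pd0)
          next
            case False
            then have "\<theta> > 0" using \<theta> by simp
            have le: "sqrt (real n) * \<theta> \<le> R'" using \<theta> by (simp add: R'_def le_max_iff_disj)
            then have "\<theta> < d" using elim(2) by blast
            have "L < r * (real n powr ((1 + s) / 2) * lam n)"
              using elim(1) r by (simp add: pos_divide_less_eq mult.commute)
            also have "real n powr ((1 + s) / 2) = sqrt (real n) * sqrt (real n) powr s"
            proof -
              have "real n powr ((1 + s) / 2) = (real n powr (1 / 2)) powr (1 + s)"
                by (simp add: powr_powr)
              also have "\<dots> = sqrt (real n) powr (1 + s)" by (simp add: powr_half_sqrt)
              also have "\<dots> = sqrt (real n) * sqrt (real n) powr s"
                using elim(3) by (simp add: powr_add)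
              finally show ?thesis .
            qed
            also have "r * (sqrt (real n) * sqrt (real n) powr s * lam n)
                = sqrt (real n) * (lam n * (c * (R' powr (- s) * sqrt (real n) powr s)))"
              by (simp add: r_def mult_ac)
            also have "R' powr (- s) * sqrt (real n) powr s \<le> (sqrt (real n) * \<theta>) powr (- s) * sqrt (real n) powr s"
              using le elim(3) \<open>\<theta> > 0\<close> \<open>s > 0\<close> by (intro mult_right_mono powr_mono2') auto
            also have "(sqrt (real n) * \<theta>) powr (- s) * sqrt (real n) powr s = \<theta> powr (- s)"
              using elim(3) \<open>\<theta> > 0\<close> by (simp add: powr_mult powr_minus field_simps)
            also have "c * \<theta> powr (- s) \<le> deriv p \<theta>"
              using d(2) \<open>\<theta> > 0\<close> \<open>\<theta> < d\<close> by blast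
            finally have "L < sqrt (real n) * (lam n * deriv p \<theta>)"
              using c(1) less_imp_le[OF pos[of n]] by (simp add: mult_left_mono)
            then show ?thesis by (simp add: pd[OF \<open>\<theta> > 0\<close>])
          qed
        qed
      qed
    qed
    show "\<forall>\<^sub>F n in sequentially. \<forall>\<theta>\<ge>0. sqrt (real n) * \<bar>\<theta> - \<theta>\<^sub>0\<bar> \<le> R \<longrightarrow>
        ereal (sqrt (real n)) * pen_deriv (\<lambda>\<theta>. lam n * p \<theta>) \<theta> \<le> ereal \<delta>"
      if "\<theta>\<^sub>0 > 0 \<and> \<delta> > 0" for \<theta>\<^sub>0 R \<delta>
    proof -
      define D where "D = deriv p \<theta>\<^sub>0 + 1"
      have D: "D > 0" using deriv_nonneg[of \<theta>\<^sub>0] that by (simp add: D_def)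
      have "isCont (deriv p) \<theta>\<^sub>0"
        using cont that by (simp add: continuous_on_eq_continuous_at)
      then obtain r where r: "r > 0" "\<And>\<theta>. \<bar>\<theta> - \<theta>\<^sub>0\<bar> < r \<Longrightarrow> \<bar>deriv p \<theta> - deriv p \<theta>\<^sub>0\<bar> < 1"
        unfolding continuous_at_eps_delta dist_real_def by (meson zero_less_one)
      have "\<forall>\<^sub>F n in sequentially. sqrt (real n) * lam n < \<delta> / D"
        using that D by (intro order_tendstoD(2)[OF small]) auto
      moreover have "\<forall>\<^sub>F n in sequentially. \<forall>z. sqrt (real n) * z \<le> R \<longrightarrow> z < min r \<theta>\<^sub>0"
        using that r(1) by (intro eventually_local_window) auto
      ultimately show ?thesis
      proof eventually_elim
        case (elim n)
        show ?case
        proof (intro allI impI)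
          fix \<theta> :: real assume "\<theta> \<ge> 0" "sqrt (real n) * \<bar>\<theta> - \<theta>\<^sub>0\<bar> \<le> R"
          with elim(2) have \<theta>: "\<bar>\<theta> - \<theta>\<^sub>0\<bar> < min r \<theta>\<^sub>0" by blast
          then have "\<theta> > 0" by linarith
          have "deriv p \<theta> \<le> D" using r(2)[of \<theta>] \<theta> by (simp add: D_def)
          then have "sqrt (real n) * lam n * deriv p \<theta> \<le> sqrt (real n) * lam n * D"
            using pos[of n] by (intro mult_left_mono) auto
          also have "\<dots> \<le> \<delta>" using elim(1) D by (simp add: pos_less_divide_eq)
          finally show "ereal (sqrt (real n)) * pen_deriv (\<lambda>\<theta>. lam n * p \<theta>) \<theta> \<le> ereal \<delta>"
            by (simp add: pd[OF \<open>\<theta> > 0\<close>] mult.assoc)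
        qed
      qed
    qed
  qed
qed

theorem theorem4:
  fixes M :: "'a measure"
    and x :: "nat \<Rightarrow> 'a \<Rightarrow> real^'p"
    and \<epsilon> y :: "nat \<Rightarrow> 'a \<Rightarrow> real"
    and \<beta>\<^sub>0 :: "real^'p"
    and \<sigma> :: real
    and C :: "real^'p^'p"
    and e :: "'q::finite \<Rightarrow> 'p"
    and lam :: "nat \<Rightarrow> real"
    and b0 b :: "nat \<Rightarrow> 'a \<Rightarrow> real^'p"
  assumes "linear_model M x \<epsilon> y \<beta>\<^sub>0 \<sigma>"
    and "AE \<omega> in M. (\<lambda>n. (1 / real n) *\<^sub>R gram n (\<lambda>i. x i \<omega>)) \<longlonglongrightarrow> C"
    and "pos_definite C"
    and "ols_estimator M x y b0"
    and "\<And>n. lam n > 0"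
  shows "(\<forall>a. a > 2 \<and>
            one_step_estimator M x y (\<lambda>n. scad a (lam n)) b0 b \<and>
            filterlim (\<lambda>n. sqrt (real n) * lam n) at_top sequentially \<and>
            lam \<longlonglongrightarrow> 0 \<longrightarrow>
            sparsity M \<beta>\<^sub>0 b \<and> asymptotic_normality e M \<beta>\<^sub>0 \<sigma> C b)
       \<and> (\<forall>(p :: real \<Rightarrow> real) s.
            one_step_estimator M x y (\<lambda>n \<theta>. lam n * p \<theta>) b0 b \<and>
            mono_on {0<..} p \<and>
            p differentiable_on {0<..} \<and>
            continuous_on {0<..} (deriv p) \<and>
            s > 0 \<and>
            deriv p \<in> \<Theta>[at_right 0](\<lambda>\<theta>. \<theta> powr (- s)) \<and>
            filterlim (\<lambda>n. real n powr ((1 + s) / 2) * lam n) at_top sequentially \<and>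
            (\<lambda>n. sqrt (real n) * lam n) \<longlonglongrightarrow> 0 \<longrightarrow>
            sparsity M \<beta>\<^sub>0 b \<and> asymptotic_normality e M \<beta>\<^sub>0 \<sigma> C b)"
proof -
  have "sparsity M \<beta>\<^sub>0 b \<and> asymptotic_normality e M \<beta>\<^sub>0 \<sigma> C b"
    if "separating_penalties P" "one_step_estimator M x y P b0 b" for P
    using sparsity_of_one_step[OF assms(1-4) that] asymptotic_normality_of_one_step[OF assms(1-4) that] by blast
  note conclusion = this
  show ?thesis
  proof (rule conjI; (rule allI)+; rule impI; elim conjE)
    fix a
    assume "a > 2" "filterlim (\<lambda>n. sqrt (real n) * lam n) at_top sequentially" "lam \<longlonglongrightarrow> 0"
      and ose: "one_step_estimator M x y (\<lambda>n. scad a (lam n)) b0 b"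
    then have "separating_penalties (\<lambda>n. scad a (lam n))"
      by (intro separating_penalties_scad assms(5))
    then show "sparsity M \<beta>\<^sub>0 b \<and> asymptotic_normality e M \<beta>\<^sub>0 \<sigma> C b" using ose by (rule conclusion)
  next
    fix p s
    assume "mono_on {0<..} p" "p differentiable_on {0<..}" "continuous_on {0<..} (deriv p)" "s > 0"
      "deriv p \<in> \<Theta>[at_right 0](\<lambda>\<theta>. \<theta> powr (- s))"
      "filterlim (\<lambda>n. real n powr ((1 + s) / 2) * lam n) at_top sequentially"
      "(\<lambda>n. sqrt (real n) * lam n) \<longlonglongrightarrow> 0"
      and ose: "one_step_estimator M x y (\<lambda>n \<theta>. lam n * p \<theta>) b0 b"
    then have "separating_penalties (\<lambda>n \<theta>. lam n * p \<theta>)"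
      by (intro separating_penalties_power_singularity assms(5))
    then show "sparsity M \<beta>\<^sub>0 b \<and> asymptotic_normality e M \<beta>\<^sub>0 \<sigma> C b" using ose by (rule conclusion)
  qed
qed

end
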